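(* Let $D_1,D_2,E$ be effective divisors of degree $\delta$ on $C$ such that $D_0,D_1,D_2$ are disjoint from $E_0,E$. Let $0\neq s\in V_3$ and $0\neq t\in V_2$ be sections such that $$(s)_3=D_1+D_2+D_3,\qquad (t)_2=D_3+D_4$$ for some effective divisors $D_3,D_4$ of degree $\delta$ which are both disjoint from $E$ and $E_0$. Then the points $x_i=[\mathcal L^\vee(D_i)]\in J(K)$ satisfy $x_4=x_1+x_2$, and $$[D_1,E]\overset{1}{\otimes}[D_2,E]=\lambda\cdot[D_4,E],\qquad\lambda=\left(\frac{s}{t\,d_0}\right)(E)\cdot\left(\frac{t\,d_0}{s}\right)(E_0)\in K^\times.$$
   Context: $K$ is a field, $C$ is a nonsingular, complete, geometrically integral curve over $K$ of genus $g$ with $C(K)\neq\emptyset$, and $J$ is its Jacobian, so $J(K)=\operatorname{Pic}^0(C)$. For a nonzero rational function $f$, $(f)$ is its divisor; if $F=\sum_P n_P P$ is a divisor with support disjoint from that of $(f)$, then $f(F)=\prod_P N_{\kappa(P)/K}(f(P))^{n_P}\in K^\times$. For sections $s_1,s_2$ of the same line bundle and an effective divisor $F$ disjoint from their divisors, $(s_1/s_2)(F)$ is the value at $F$ of the rational function $s_1/s_2$. Norms: for a divisor $F=\sum_P n_PP$ and a line bundle $\mathcal M$ on $C$, $\mathcal N_F(\mathcal M)$ is the one-dimensional $K$-vector space $\bigotimes_P \mathrm{Norm}_{\kappa(P)/K}(\mathcal M|_P)^{\otimes n_P}$. It is additive in $F$ and functorial and multiplicative in $\mathcal M$. A meromorphic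 section $s$ of $\mathcal M$ which is regular and non-vanishing around $\operatorname{Supp}F$ has a nonzero norm $\mathcal N_F(s\in\mathcal M)$, and $\mathcal N_F(hs)=h(F)\,\mathcal N_F(s)$ for a function $h$ regular and non-vanishing around $\operatorname{Supp}F$. Poincaré torsor: $\mathcal P$ is the Poincaré (Mumford) bundle on $J\times J$ (identifying $J$ with its dual). For $x=[D]$, $y=[E]\in J(K)$ with $D,E\in\operatorname{Div}^0(C)$, its fibre at $(x,y)$ is $\mathcal P_{x,y}=\mathcal N_D(\mathcal O_C(E))$, where the spaces obtained from different choices of $D,E$ are identified as follows: (i) $\mathcal N_D(\mathcal O_C(E+(f)))\simeq\mathcal N_D(\mathcal O_C(E))$ is induced by the isomorphism $\mathcal O_C(E+(f))\to\mathcal O_C(E)$, $h\mapsto fh$; (ii) $\mathcal N_{D+(f)}(\mathcal O_C(E))\simeq\mathcal N_D(\mathcal O_C(E))$ identifies $\mathcal N_{D+(f)}(s)$ with $f((s)_E)\cdot\mathcal N_D(s)$, for any meromorphic section $s$ of $\mathcal O_C(E)$ whose divisor $(s)_E$ as a section of $\mathcal O_C(E)$ is disjoint from $D$ and from $(f)$. $\mathcal P^\times$ is $\mathcal P$ with its zero section removed; its fibres are $K^\times$-torsors, the action being written $\lambda\cdot\pi$. For $D,E\in\operatorname{Div}^0(C)$ with disjoint supports, $(D,E)$ denotes the point $\mathcal N_D(1\in\mathcal O_C(E))\in\mathcal P^\times_{[D],[E]}$. The left partial group law $\overset{1}{\otimes}:\mathcal P^\times_{x,y}\times\mathcal P^\times_{x',y}\to\mathcal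 P^\times_{x+x',y}$ is induced by the canonical isomorphism $\mathcal N_D(\mathcal O_C(E))\otimes\mathcal N_{D'}(\mathcal O_C(E))\simeq\mathcal N_{D+D'}(\mathcal O_C(E))$. Fix a line bundle $\mathcal L$ on $C$ of degree $\delta\ge 2g+1$, with dual $\mathcal L^\vee$, and put $V_n=H^0(C,\mathcal L^{\otimes n})$. For $0\ne s\in V_n$, $(s)_n$ is its divisor as a section of $\mathcal L^{\otimes n}$. Fix nonzero $d_0,e_0\in V_1$ whose divisors $D_0=(d_0)_1$ and $E_0=(e_0)_1$ are disjoint. An effective divisor $D$ of degree $\delta$ represents the point $[\mathcal L^\vee(D)]=[D-D_0]=[D-E_0]$ of $J(K)$. For effective divisors $D,E$ of degree $\delta$ such that $D$ and $D_0$ are disjoint from $E$ and $E_0$, put $[D,E]:=(D-D_0,\,E-E_0)\in\mathcal P^\times$. "Disjoint" means having disjoint supports. *)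

theory Defs
  imports
    "HOL-Algebra.Coset"
    "HOL-Algebra.Algebraic_Closure_Type"
    "HOL-Library.Function_Algebras"
    "Jordan_Normal_Form.Determinant"
begin

section \<open>Quotients of vector spaces\<close>

text \<open>
  Residue fields and cohomology groups are quotients \<open>V / W\<close> of subspaces of some ambient
  vector space with scalar multiplication \<open>scl\<close>. A list of elements of \<open>V\<close> is a basis of
  the quotient if every element of \<open>V\<close> has unique coordinates modulo \<open>W\<close>. When no finite
  basis exists the dimension is \<open>0\<close> and the norm below is \<open>1\<close>; for the spaces
  considered here this does not happen.
\<close>

definition lin_comb ::
    "('k::field \<Rightarrow> 'v::ab_group_add \<Rightarrow> 'v) \<Rightarrow> 'v list \<Rightarrow> 'k vec \<Rightarrow> 'v" where
  "lin_comb scl bs c = (\<Sum>i<length bs. scl (c $ i) (bs ! i))"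

definition quot_basis ::
    "('k::field \<Rightarrow> 'v::ab_group_add \<Rightarrow> 'v) \<Rightarrow> 'v set \<Rightarrow> 'v set \<Rightarrow> 'v list \<Rightarrow> bool" where
  "quot_basis scl V W bs \<longleftrightarrow> set bs \<subseteq> V \<and>
     (\<forall>v\<in>V. \<exists>!c. c \<in> carrier_vec (length bs) \<and> v - lin_comb scl bs c \<in> W)"

definition quot_coords ::
    "('k::field \<Rightarrow> 'v::ab_group_add \<Rightarrow> 'v) \<Rightarrow> 'v set \<Rightarrow> 'v list \<Rightarrow> 'v \<Rightarrow> 'k vec" where
  "quot_coords scl W bs v =
     (THE c. c \<in> carrier_vec (length bs) \<and> v - lin_comb scl bs c \<in> W)"

definition quot_dim ::
    "('k::field \<Rightarrow> 'v::ab_group_add \<Rightarrow> 'v) \<Rightarrow> 'v set \<Rightarrow> 'v set \<Rightarrow> nat" where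
  "quot_dim scl V W = (if \<exists>bs. quot_basis scl V W bs
     then length (SOME bs. quot_basis scl V W bs) else 0)"


section \<open>Curves\<close>

text \<open>
  A nonsingular complete integral curve \<open>C\<close> over \<open>K\<close> is given by its function field
  \<open>F\<close>, finitely generated of transcendence degree 1 over \<open>K\<close>: the closed points of
  \<open>C\<close> correspond, through their local rings, to the discrete valuation rings of \<open>F/K\<close>
  (EGA II, 7.4; Hartshorne I.6). Here \<open>K\<close> and \<open>F\<close> are types and the inclusion is
  \<open>emb\<close>; a closed point is identified with its local ring, a subset of \<open>F\<close>.
\<close>

definition max_ideal :: "'f::field set \<Rightarrow> 'f set" where
  "max_ideal P = {f \<in> P. f = 0 \<or> inverse f \<notin> P}"

definition local_units :: "'f::field set \<Rightarrow> 'f set" where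
  "local_units P = {f \<in> P. f \<noteq> 0 \<and> inverse f \<in> P}"

definition uniformizer :: "'f::field set \<Rightarrow> 'f \<Rightarrow> bool" where
  "uniformizer P t \<longleftrightarrow> t \<noteq> 0 \<and> t \<in> max_ideal P \<and>
     (\<forall>f. f \<noteq> 0 \<longrightarrow> (\<exists>(n::int). \<exists>u\<in>local_units P. f = u * t powi n))"

definition val_at :: "'f::field set \<Rightarrow> 'f \<Rightarrow> int" where
  "val_at P f = (THE n. \<exists>t u. uniformizer P t \<and> u \<in> local_units P \<and> f = u * t powi n)"

context
  fixes emb :: "'k::field \<Rightarrow> 'f::field"
begin

definition is_function_field :: bool where
  "is_function_field \<longleftrightarrow>
     (\<exists>x. (\<forall>p. p \<noteq> 0 \<longrightarrow> poly (map_poly emb p) x \<noteq> 0) \<and>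
          (\<exists>B. finite B \<and>
             (\<forall>f. \<exists>c. (\<forall>b\<in>B. c b \<in> {poly (map_poly emb p) x / poly (map_poly emb q) x |p q. q \<noteq> 0})
                    \<and> f = (\<Sum>b\<in>B. c b * b))))"

text \<open>
  \<open>C\<close> is geometrically integral iff \<open>F \<otimes>\<^sub>K K'\<close> is a domain, \<open>K'\<close> an algebraic closure
  of \<open>K\<close>. A list of pairs stands for the sum of the corresponding pure tensors. This sum
  vanishes iff every bilinear form vanishes on it, since a vector space is separated by its
  linear forms.
\<close>

definition bilinear_form :: "('f \<Rightarrow> 'k alg_closure \<Rightarrow> 'k) \<Rightarrow> bool" where
  "bilinear_form \<beta> \<longleftrightarrow>
     (\<forall>a a' b. \<beta> (a + a') b = \<beta> a b + \<beta> a' b) \<and> (\<forall>a b b'. \<beta> a (b + b') = \<beta> a b + \<beta> a b') \<and>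
     (\<forall>c a b. \<beta> (emb c * a) b = c * \<beta> a b) \<and> (\<forall>c a b. \<beta> a (to_ac c * b) = c * \<beta> a b)"

definition tensor_is_zero :: "('f \<times> 'k alg_closure) list \<Rightarrow> bool" where
  "tensor_is_zero xs \<longleftrightarrow> (\<forall>\<beta>. bilinear_form \<beta> \<longrightarrow> (\<Sum>(a, b)\<leftarrow>xs. \<beta> a b) = 0)"

definition geometrically_integral :: bool where
  "geometrically_integral \<longleftrightarrow>
     (\<forall>xs ys. tensor_is_zero [(a * a', b * b'). (a, b) \<leftarrow> xs, (a', b') \<leftarrow> ys] \<longrightarrow>
              tensor_is_zero xs \<or> tensor_is_zero ys)"

definition is_curve :: bool where
  "is_curve \<longleftrightarrow> field_hom emb \<and> is_function_field \<and> geometrically_integral"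

definition points :: "'f set set" where
  "points = {P. range emb \<subseteq> P \<and> (\<forall>a\<in>P. \<forall>b\<in>P. a - b \<in> P \<and> a * b \<in> P) \<and> (\<exists>t. uniformizer P t)}"

definition rational_point :: "'f set \<Rightarrow> bool" where
  "rational_point P \<longleftrightarrow> P \<in> points \<and> (\<forall>f\<in>P. \<exists>c. f - emb c \<in> max_ideal P)"

definition point_degree :: "'f set \<Rightarrow> nat" where
  "point_degree P = quot_dim (\<lambda>c a. emb c * a) P (max_ideal P)"

text \<open>
  The norm from \<open>\<kappa>(P) = P / max_ideal P\<close> to \<open>K\<close> of the value \<open>f(P)\<close>, that is, the
  determinant of multiplication by \<open>f(P)\<close> on the \<open>K\<close>-vector space \<open>\<kappa>(P)\<close>.
\<close>

definition norm_at :: "'f set \<Rightarrow> 'f \<Rightarrow> 'k" where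
  "norm_at P f = (let scl = (\<lambda>c a. emb c * a); W = max_ideal P in
     if \<exists>bs. quot_basis scl P W bs
     then let bs = (SOME bs. quot_basis scl P W bs); n = length bs
          in det (mat n n (\<lambda>(i, j). quot_coords scl W bs (f * bs ! j) $ i))
     else 1)"

text \<open>
  The genus is the dimension of \<open>H\<^sup>1(C, \<O>\<^sub>C)\<close>, computed by the flasque resolution
  \<open>0 \<rightarrow> \<O>\<^sub>C \<rightarrow> F \<rightarrow> F/\<O>\<^sub>C \<rightarrow> 0\<close> as the cokernel of \<open>F \<rightarrow> \<Oplus>\<^sub>P F/\<O>\<^sub>P\<close>.
\<close>

definition adeles :: "('f set \<Rightarrow> 'f) set" where
  "adeles = {a. (\<forall>P. P \<notin> points \<longrightarrow> a P = 0) \<and> finite {P \<in> points. a P \<notin> P}}"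

definition genus :: nat where
  "genus = quot_dim (\<lambda>c a P. emb c * a P) adeles
     {a \<in> adeles. \<exists>f. \<forall>P\<in>points. a P - f \<in> P}"


section \<open>Divisors\<close>

definition support :: "('f set \<Rightarrow> int) \<Rightarrow> 'f set set" where
  "support D = {P. D P \<noteq> 0}"

definition disjoint_div :: "('f set \<Rightarrow> int) \<Rightarrow> ('f set \<Rightarrow> int) \<Rightarrow> bool" where
  "disjoint_div D E \<longleftrightarrow> support D \<inter> support E = {}"

definition divisors :: "('f set \<Rightarrow> int) set" where
  "divisors = {D. finite (support D) \<and> support D \<subseteq> points}"

definition div_degree :: "('f set \<Rightarrow> int) \<Rightarrow> int" where
  "div_degree D = (\<Sum>P\<in>support D. D P * int (point_degree P))"

definition divisors0 :: "('f set \<Rightarrow> int) set" where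
  "divisors0 = {D \<in> divisors. div_degree D = 0}"

definition effective_of_degree :: "int \<Rightarrow> ('f set \<Rightarrow> int) \<Rightarrow> bool" where
  "effective_of_degree d D \<longleftrightarrow> D \<in> divisors \<and> (\<forall>P. D P \<ge> 0) \<and> div_degree D = d"

definition fun_div :: "'f \<Rightarrow> 'f set \<Rightarrow> int" where
  "fun_div f P = (if P \<in> points then val_at P f else 0)"

definition eval_div :: "'f \<Rightarrow> ('f set \<Rightarrow> int) \<Rightarrow> 'k" where
  "eval_div f D = (\<Prod>P\<in>support D. norm_at P f powi D P)"

text \<open>The group \<open>J(K) = Pic\<^sup>0(C)\<close> of divisors of degree 0 modulo principal divisors.\<close>

definition jacobian :: "('f set \<Rightarrow> int) set monoid" where
  "jacobian = \<lparr>carrier = divisors0, monoid.mult = (+), one = 0\<rparr> Mod {fun_div f |f. f \<noteq> 0}"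


section \<open>Line bundles\<close>

text \<open>
  Line bundles are realised as invertible subsheaves of the constant sheaf \<open>F\<close> (every line
  bundle on an integral curve is isomorphic to one of these), given by their stalks \<open>M P\<close>.
  Meromorphic sections are then elements of \<open>F\<close>, tensor products are products of stalks in
  \<open>F\<close>, and \<open>\<O>\<^sub>C\<close> has stalk \<open>P\<close> at \<open>P\<close>.
\<close>

definition local_gen :: "('f set \<Rightarrow> 'f set) \<Rightarrow> 'f set \<Rightarrow> 'f \<Rightarrow> bool" where
  "local_gen M P g \<longleftrightarrow> g \<noteq> 0 \<and> M P = (\<lambda>a. g * a) ` P"

definition line_bundle :: "('f set \<Rightarrow> 'f set) \<Rightarrow> bool" where
  "line_bundle M \<longleftrightarrow> (\<forall>P\<in>points. \<exists>g. local_gen M P g) \<and> finite {P \<in> points. M P \<noteq> P}"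

text \<open>
  Stalks are free of rank 1, so the products \<open>a * b\<close> already form a module.
\<close>

definition bundle_tensor :: "('f set \<Rightarrow> 'f set) \<Rightarrow> ('f set \<Rightarrow> 'f set) \<Rightarrow> 'f set \<Rightarrow> 'f set" where
  "bundle_tensor M N P = {a * b |a b. a \<in> M P \<and> b \<in> N P}"

fun bundle_pow :: "('f set \<Rightarrow> 'f set) \<Rightarrow> nat \<Rightarrow> 'f set \<Rightarrow> 'f set" where
  "bundle_pow M 0 = (\<lambda>P. P)"
| "bundle_pow M (Suc n) = bundle_tensor (bundle_pow M n) M"

definition bundle_dual :: "('f set \<Rightarrow> 'f set) \<Rightarrow> 'f set \<Rightarrow> 'f set" where
  "bundle_dual M P = {a. \<forall>b\<in>M P. a * b \<in> P}"

definition O_bundle :: "('f set \<Rightarrow> int) \<Rightarrow> 'f set \<Rightarrow> 'f set" where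
  "O_bundle D P = {h. h = 0 \<or> val_at P h + D P \<ge> 0}"

definition global_sections :: "('f set \<Rightarrow> 'f set) \<Rightarrow> 'f set" where
  "global_sections M = {s. \<forall>P\<in>points. s \<in> M P}"

text \<open>The divisor of a nonzero meromorphic section \<open>s\<close> as a section of \<open>M\<close>.\<close>

definition section_div :: "('f set \<Rightarrow> 'f set) \<Rightarrow> 'f \<Rightarrow> 'f set \<Rightarrow> int" where
  "section_div M s P = (if P \<in> points then val_at P (s / (SOME g. local_gen M P g)) else 0)"

text \<open>
  The degree of \<open>M\<close> is the common degree of the divisors of its nonzero meromorphic sections.
\<close>

definition has_bundle_degree :: "('f set \<Rightarrow> 'f set) \<Rightarrow> int \<Rightarrow> bool" where
  "has_bundle_degree M d \<longleftrightarrow> (\<forall>s. s \<noteq> 0 \<longrightarrow> div_degree (section_div M s) = d)"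

text \<open>
  The class \<open>[M]\<close> in \<open>Pic(C)\<close>, as a class of divisors modulo principal divisors; thus
  \<open>[\<O>\<^sub>C(D)] = [D]\<close>.
\<close>

definition bundle_class :: "('f set \<Rightarrow> 'f set) \<Rightarrow> ('f set \<Rightarrow> int) set" where
  "bundle_class M = {section_div M s |s. s \<noteq> 0}"


section \<open>Norms\<close>

text \<open>
  A frame chooses a generator \<open>\<sigma> P\<close> of every stalk of \<open>M\<close>. It determines a basis vector
  \<open>e\<^sub>\<sigma> = \<Otimes>\<^sub>P Norm(\<sigma> P)\<^bsup>D P\<^esup>\<close> of
  \<open>N\<^sub>D(M) = \<Otimes>\<^sub>P Norm\<^bsub>\<kappa>(P)/K\<^esub>(M|\<^sub>P)\<^bsup>\<otimes> D P\<^esup>\<close>, and a change of frame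
  multiplies it by a norm: \<open>e\<^sub>\<tau> = (\<Prod>\<^sub>P N(\<tau> P / \<sigma> P)\<^bsup>D P\<^esup>) e\<^sub>\<sigma>\<close>. A vector of
  \<open>N\<^sub>D(M)\<close> is represented by its coordinates with respect to all \<open>e\<^sub>\<sigma>\<close>, that is, by the
  function \<open>\<phi>\<close> such that the vector is \<open>\<phi> \<sigma> e\<^sub>\<sigma>\<close> for every frame \<open>\<sigma>\<close> (and \<open>\<phi> \<sigma> = 0\<close>
  if \<open>\<sigma>\<close> is not a frame). As frames do not depend on \<open>D\<close>, the isomorphism
  \<open>N\<^sub>D(M) \<otimes> N\<^sub>D\<^sub>'(M) \<simeq> N\<^bsub>D+D'\<^esub>(M)\<close> is the pointwise product of coordinates.
\<close>

definition frame :: "('f set \<Rightarrow> 'f set) \<Rightarrow> ('f set \<Rightarrow> 'f) \<Rightarrow> bool" where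
  "frame M \<sigma> \<longleftrightarrow> (\<forall>P\<in>points. local_gen M P (\<sigma> P))"

definition norm_space ::
    "('f set \<Rightarrow> int) \<Rightarrow> ('f set \<Rightarrow> 'f set) \<Rightarrow> (('f set \<Rightarrow> 'f) \<Rightarrow> 'k) set" where
  "norm_space D M = {\<phi>. (\<forall>\<sigma>. \<not> frame M \<sigma> \<longrightarrow> \<phi> \<sigma> = 0) \<and>
     (\<forall>\<sigma> \<tau>. frame M \<sigma> \<longrightarrow> frame M \<tau> \<longrightarrow>
        \<phi> \<sigma> = (\<Prod>P\<in>support D. norm_at P (\<tau> P / \<sigma> P) powi D P) * \<phi> \<tau>)}"

text \<open>
  The norm of a meromorphic section \<open>s\<close> of \<open>M\<close> that is regular and non-vanishing around the
  support of \<open>D\<close>.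
\<close>

definition section_norm ::
    "('f set \<Rightarrow> int) \<Rightarrow> ('f set \<Rightarrow> 'f set) \<Rightarrow> 'f \<Rightarrow> ('f set \<Rightarrow> 'f) \<Rightarrow> 'k" where
  "section_norm D M s \<sigma> =
     (if frame M \<sigma> then (\<Prod>P\<in>support D. norm_at P (s / \<sigma> P) powi D P) else 0)"

text \<open>
  The map \<open>N\<^sub>D(M) \<rightarrow> N\<^sub>D(M')\<close> induced by the isomorphism \<open>M \<rightarrow> M'\<close>, \<open>h \<mapsto> f * h\<close>, where
  \<open>M' = f M\<close>: it takes \<open>e\<^sub>\<sigma>\<close> to \<open>e\<^bsub>f\<sigma>\<^esub>\<close>.
\<close>

definition norm_map :: "'f \<Rightarrow> (('f set \<Rightarrow> 'f) \<Rightarrow> 'k) \<Rightarrow> ('f set \<Rightarrow> 'f) \<Rightarrow> 'k" where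
  "norm_map f \<phi> \<tau> = \<phi> (\<lambda>P. \<tau> P / f)"


section \<open>The Poincare torsor\<close>

text \<open>
  A triple \<open>(D, E, \<phi>)\<close> stands for the nonzero element \<open>\<phi>\<close> of \<open>N\<^sub>D(\<O>\<^sub>C(E))\<close>. Points of the
  torsor are classes of triples modulo the equivalence relation generated by the
  identifications below; the fibre over \<open>([D], [E])\<close> is a copy of \<open>N\<^sub>D(\<O>\<^sub>C(E)) - {0}\<close>.
\<close>

definition poincare_triples ::
    "(('f set \<Rightarrow> int) \<times> ('f set \<Rightarrow> int) \<times> (('f set \<Rightarrow> 'f) \<Rightarrow> 'k)) set" where
  "poincare_triples = {(D, E, \<phi>). D \<in> divisors0 \<and> E \<in> divisors0 \<and>
     \<phi> \<in> norm_space D (O_bundle E) \<and> \<phi> \<noteq> 0}"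

inductive identification ::
    "('f set \<Rightarrow> int) \<times> ('f set \<Rightarrow> int) \<times> (('f set \<Rightarrow> 'f) \<Rightarrow> 'k) \<Rightarrow>
     ('f set \<Rightarrow> int) \<times> ('f set \<Rightarrow> int) \<times> (('f set \<Rightarrow> 'f) \<Rightarrow> 'k) \<Rightarrow> bool" where
  change_E: "identification (D, E + fun_div f, \<phi>) (D, E, norm_map f \<phi>)"
    if "f \<noteq> 0"
       "(D, E + fun_div f, \<phi>) \<in> poincare_triples"
       "(D, E, norm_map f \<phi>) \<in> poincare_triples"
| change_D: "identification
      (D + fun_div f, E, \<lambda>\<sigma>. c * section_norm (D + fun_div f) (O_bundle E) s \<sigma>)
      (D, E, \<lambda>\<sigma>. c * (eval_div f (section_div (O_bundle E) s) * section_norm D (O_bundle E) s \<sigma>))"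
    if "f \<noteq> 0" "s \<noteq> 0" "c \<noteq> 0"
       "D \<in> divisors0" "D + fun_div f \<in> divisors0" "E \<in> divisors0"
       "disjoint_div (section_div (O_bundle E) s) D"
       "disjoint_div (section_div (O_bundle E) s) (fun_div f)"

definition poincare_point ::
    "('f set \<Rightarrow> int) \<times> ('f set \<Rightarrow> int) \<times> (('f set \<Rightarrow> 'f) \<Rightarrow> 'k) \<Rightarrow>
     (('f set \<Rightarrow> int) \<times> ('f set \<Rightarrow> int) \<times> (('f set \<Rightarrow> 'f) \<Rightarrow> 'k)) set" where
  "poincare_point t = {t'. equivclp identification t t'}"

definition poincare_fibre ::
    "('f set \<Rightarrow> int) set \<Rightarrow> ('f set \<Rightarrow> int) set \<Rightarrow>
     (('f set \<Rightarrow> int) \<times> ('f set \<Rightarrow> int) \<times> (('f set \<Rightarrow> 'f) \<Rightarrow> 'k)) set set" where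
  "poincare_fibre x y =
     {poincare_point (D, E, \<phi>) |D E \<phi>. D \<in> x \<and> E \<in> y \<and> (D, E, \<phi>) \<in> poincare_triples}"

definition poincare_scale ::
    "'k \<Rightarrow> (('f set \<Rightarrow> int) \<times> ('f set \<Rightarrow> int) \<times> (('f set \<Rightarrow> 'f) \<Rightarrow> 'k)) set \<Rightarrow>
     (('f set \<Rightarrow> int) \<times> ('f set \<Rightarrow> int) \<times> (('f set \<Rightarrow> 'f) \<Rightarrow> 'k)) set" where
  "poincare_scale c p = (\<lambda>(D, E, \<phi>). (D, E, \<lambda>\<sigma>. c * \<phi> \<sigma>)) ` p"

text \<open>The left partial group law, on pairs of points with the same second coordinate \<open>[E]\<close>.\<close>

definition left_mult ::
    "(('f set \<Rightarrow> int) \<times> ('f set \<Rightarrow> int) \<times> (('f set \<Rightarrow> 'f) \<Rightarrow> 'k)) set \<Rightarrow>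
     (('f set \<Rightarrow> int) \<times> ('f set \<Rightarrow> int) \<times> (('f set \<Rightarrow> 'f) \<Rightarrow> 'k)) set \<Rightarrow>
     (('f set \<Rightarrow> int) \<times> ('f set \<Rightarrow> int) \<times> (('f set \<Rightarrow> 'f) \<Rightarrow> 'k)) set" where
  "left_mult p q = (THE r. \<exists>D D' E \<phi> \<psi>. (D, E, \<phi>) \<in> p \<and> (D', E, \<psi>) \<in> q \<and>
     r = poincare_point (D + D', E, \<lambda>\<sigma>. \<phi> \<sigma> * \<psi> \<sigma>))"

text \<open>The point \<open>(D, E)\<close>, for \<open>D\<close> and \<open>E\<close> of degree 0 with disjoint supports.\<close>

definition div_pair ::
    "('f set \<Rightarrow> int) \<Rightarrow> ('f set \<Rightarrow> int) \<Rightarrow>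
     (('f set \<Rightarrow> int) \<times> ('f set \<Rightarrow> int) \<times> (('f set \<Rightarrow> 'f) \<Rightarrow> 'k)) set" where
  "div_pair D E = poincare_point (D, E, section_norm D (O_bundle E) 1)"

end

end

theory Submission
  imports Defs
begin

text \<open>
  Put \<open>f = s / (t d\<^sub>0)\<close>. Then \<open>(f) = D\<^sub>1 + D\<^sub>2 - D\<^sub>4 - D\<^sub>0\<close>, which gives \<open>x\<^sub>4 = x\<^sub>1 + x\<^sub>2\<close>; moreover
  \<open>[D\<^sub>1, E] \<otimes> [D\<^sub>2, E]\<close> is the norm of the section \<open>1\<close> along \<open>D\<^sub>4 - D\<^sub>0 + (f)\<close>, which is identified
  with \<open>f(E - E\<^sub>0)\<close> times the norm of \<open>1\<close> along \<open>D\<^sub>4 - D\<^sub>0\<close>.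

  The work lies in showing that the product of two classes is independent of representatives. An
  identification in one factor remains valid after multiplication by an element over a divisor \<open>B\<close>
  that avoids finitely many points. By weak approximation \<open>B\<close> can always be moved within its class,
  so one factor can be changed at a time. Two ways of transporting the second divisor differ by a
  function without zeros or poles, hence by a constant \<open>c\<close>, and \<open>c\<close> acts on norms along \<open>B\<close> by
  \<open>c\<close> to the power \<open>deg B = 0\<close>. Weil reciprocity is not needed, and finiteness and degree 0 of
  principal divisors are consequences of the existence of a line bundle of nonzero degree.
\<close>

section \<open>Valuations and weak approximation\<close>

locale function_field = field_hom emb for emb :: "'k::field \<Rightarrow> 'f::field"
begin

section \<open>Arithmetic of a single discrete valuation ring\<close>

context
  fixes P :: "'f set"
  assumes P: "P \<in> points emb"
begin

lemma diff_mem: "a \<in> P \<Longrightarrow> b \<in> P \<Longrightarrow> a - b \<in> P"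
  and mult_mem: "a \<in> P \<Longrightarrow> b \<in> P \<Longrightarrow> a * b \<in> P"
  and emb_mem: "emb c \<in> P"
  using P by (auto simp: points_def)

lemma zero_mem: "0 \<in> P" and one_mem: "1 \<in> P"
  using emb_mem[of 0] emb_mem[of 1] by (simp_all)

lemma add_mem: "a \<in> P \<Longrightarrow> b \<in> P \<Longrightarrow> a + b \<in> P"
  using diff_mem[OF _ diff_mem[OF zero_mem]] by fastforce

lemma power_mem: "a \<in> P \<Longrightarrow> a ^ n \<in> P"
  by (induction n) (auto simp: one_mem mult_mem)

lemma units_one: "1 \<in> local_units P"
  by (simp add: local_units_def one_mem)

lemma units_mult: "u \<in> local_units P \<Longrightarrow> w \<in> local_units P \<Longrightarrow> u * w \<in> local_units P"
  by (auto simp: local_units_def mult_mem)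

lemma units_inverse: "u \<in> local_units P \<Longrightarrow> inverse u \<in> local_units P"
  by (auto simp: local_units_def)

lemma units_powi: "u \<in> local_units P \<Longrightarrow> u powi n \<in> local_units P"
proof -
  assume u: "u \<in> local_units P"
  have "w \<in> local_units P \<Longrightarrow> w ^ k \<in> local_units P" for w k
    by (induction k) (auto simp: units_one units_mult)
  then show ?thesis using u units_inverse[OF u] by (auto simp: power_int_def)
qed

lemma ex_uniformizer: "\<exists>t. uniformizer P t"
  using P by (auto simp: points_def)

context
  fixes t
  assumes t: "uniformizer P t"
begin

lemma powi_uniformizer_mem_iff: "t powi n \<in> P \<longleftrightarrow> n \<ge> 0"
proof
  show "n \<ge> 0 \<Longrightarrow> t powi n \<in> P"
    using t by (auto simp: power_int_def uniformizer_def max_ideal_def power_mem)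
  show "n \<ge> 0" if "t powi n \<in> P"
  proof (rule ccontr)
    assume "\<not> n \<ge> 0"
    \<comment> \<open>The exponents \<open>n\<close> and \<open>- n - 1\<close> add up to -1, and
      the second is nonnegative. A negative power of \<open>t\<close> in \<open>P\<close> would thus
      put \<open>inverse t\<close> into \<open>P\<close>, which is impossible for an element of the
      maximal ideal.\<close>
    then have eq: "inverse t = t powi n * t ^ nat (- n - 1)"
      using t by (simp add: uniformizer_def flip: power_int_of_nat power_int_add power_int_minus)
    have "inverse t \<in> P"
      unfolding eq using that t by (intro mult_mem power_mem) (auto simp: uniformizer_def max_ideal_def)
    then show False using t by (auto simp: uniformizer_def max_ideal_def)
  qed
qed

lemma powi_uniformizer_unit_iff: "t powi n \<in> local_units P \<longleftrightarrow> n = 0"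
proof -
  have "t \<noteq> 0" using t by (simp add: uniformizer_def)
  then show ?thesis
    using powi_uniformizer_mem_iff[of n] powi_uniformizer_mem_iff[of "- n"] units_one
    by (auto simp: local_units_def power_int_minus)
qed

text \<open>Each uniformizer is a unit times a power of the other, so the two exponents have product
  1. The exponent -1 is excluded because it would put \<open>t powi (- 1)\<close> into
  \<open>P\<close>.\<close>

lemma uniformizer_unique:
  assumes t': "uniformizer P t'"
  obtains u where "u \<in> local_units P" "t' = u * t"
proof -
  have nz: "t \<noteq> 0" "t' \<noteq> 0" using t t' by (auto simp: uniformizer_def)
  obtain n u where u: "u \<in> local_units P" "t' = u * t powi n"
    using t nz by (auto simp: uniformizer_def)
  obtain m w where w: "w \<in> local_units P" "t = w * t' powi m"
    using t' nz by (auto simp: uniformizer_def)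
  have "t' powi m = u powi m * t powi (n * m)"
    by (simp add: u(2) power_int_mult_distrib power_int_mult)
  then have "t = (w * u powi m) * t powi (n * m)"
    using w(2) by (simp add: mult_ac)
  then have "t powi (1 - n * m) = w * u powi m"
    using nz by (simp add: power_int_diff field_simps)
  then have "t powi (1 - n * m) \<in> local_units P"
    using units_mult[OF w(1) units_powi[OF u(1)]] by simp
  then have "n * m = 1" by (simp add: powi_uniformizer_unit_iff)
  then have "n = 1 \<or> n = - 1" using zmult_eq_1_iff by blast
  moreover have "n \<noteq> - 1"
  proof
    assume "n = - 1"
    then have "t powi (- 1) = inverse u * t'" using u by (auto simp: local_units_def)
    also have "\<dots> \<in> P" using units_inverse[OF u(1)] t'
      by (intro mult_mem) (auto simp: local_units_def uniformizer_def max_ideal_def)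
    finally show False by (simp only: powi_uniformizer_mem_iff)
  qed
  ultimately show thesis using that u by auto
qed

text \<open>Uniformizers agree up to units, so the exponent does not depend on the uniformizer and
  the definite description in \<open>val_at\<close> is meaningful.\<close>

lemma val_eq:
  assumes "u \<in> local_units P"
  shows "val_at P (u * t powi n) = n"
  unfolding val_at_def
proof (rule the_equality)
  show "\<exists>t' u'. uniformizer P t' \<and> u' \<in> local_units P \<and> u * t powi n = u' * t' powi n"
    using assms t by blast
next
  fix m
  assume "\<exists>t' u'. uniformizer P t' \<and> u' \<in> local_units P \<and> u * t powi n = u' * t' powi m"
  then obtain t' u' where t': "uniformizer P t'" and u': "u' \<in> local_units P"
    and eq: "u * t powi n = u' * t' powi m" by blast
  obtain w where w: "w \<in> local_units P" "t' = w * t" using uniformizer_unique[OF t'] .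
  have nz: "t \<noteq> 0" "u \<noteq> 0" using t assms by (auto simp: uniformizer_def local_units_def)
  have "t powi (n - m) = inverse u * (u' * w powi m)"
    using eq w nz by (simp add: power_int_mult_distrib power_int_diff field_simps)
  also have "\<dots> \<in> local_units P"
    by (intro units_mult units_inverse units_powi assms u' w)
  finally show "m = n" by (simp add: powi_uniformizer_unit_iff)
qed

end

lemma val_decomp:
  assumes "uniformizer P t" "f \<noteq> 0"
  obtains u where "u \<in> local_units P" "f = u * t powi val_at P f"
  using assms val_eq[OF assms(1)] by (metis uniformizer_def)

lemma val_mult: "f \<noteq> 0 \<Longrightarrow> g \<noteq> 0 \<Longrightarrow> val_at P (f * g) = val_at P f + val_at P g"
proof -
  assume fg: "f \<noteq> 0" "g \<noteq> 0"
  obtain t where t: "uniformizer P t" using ex_uniformizer by blast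
  then have "t \<noteq> 0" by (simp add: uniformizer_def)
  obtain u where u: "u \<in> local_units P" "f = u * t powi val_at P f" using val_decomp[OF t fg(1)] .
  obtain w where w: "w \<in> local_units P" "g = w * t powi val_at P g" using val_decomp[OF t fg(2)] .
  have "f * g = (u * t powi val_at P f) * (w * t powi val_at P g)"
    using u(2) w(2) by simp
  also have "\<dots> = (u * w) * t powi (val_at P f + val_at P g)"
    using \<open>t \<noteq> 0\<close> by (simp add: power_int_add mult_ac)
  finally have "f * g = (u * w) * t powi (val_at P f + val_at P g)" .
  then show ?thesis using val_eq[OF t units_mult[OF u(1) w(1)]] by metis
qed

lemma val_one [simp]: "val_at P 1 = 0"
  using val_mult[of 1 1] by simp

lemma val_inverse: "f \<noteq> 0 \<Longrightarrow> val_at P (inverse f) = - val_at P f"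
  using val_mult[of f "inverse f"] by simp

lemma val_divide: "f \<noteq> 0 \<Longrightarrow> g \<noteq> 0 \<Longrightarrow> val_at P (f / g) = val_at P f - val_at P g"
  by (simp add: divide_inverse val_mult val_inverse)

lemma val_power: "f \<noteq> 0 \<Longrightarrow> val_at P (f ^ n) = int n * val_at P f"
  by (induction n) (auto simp: val_mult algebra_simps)

lemma val_powi: "f \<noteq> 0 \<Longrightarrow> val_at P (f powi n) = n * val_at P f"
  by (auto simp: power_int_def val_power val_inverse)

lemma mem_iff_val: "f \<noteq> 0 \<Longrightarrow> f \<in> P \<longleftrightarrow> val_at P f \<ge> 0"
proof -
  assume f: "f \<noteq> 0"
  obtain t where t: "uniformizer P t" using ex_uniformizer by blast
  obtain u where u: "u \<in> local_units P" "f = u * t powi val_at P f" using val_decomp[OF t f] .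
  then have "inverse u * f = t powi val_at P f" by (simp add: local_units_def field_simps)
  then have "f \<in> P \<longleftrightarrow> t powi val_at P f \<in> P"
    using u mult_mem units_inverse[OF u(1)] by (metis (no_types, lifting) local_units_def mem_Collect_eq)
  then show ?thesis by (simp add: powi_uniformizer_mem_iff[OF t])
qed

lemma unit_iff_val: "f \<in> local_units P \<longleftrightarrow> f \<noteq> 0 \<and> val_at P f = 0"
  using mem_iff_val[of f] mem_iff_val[of "inverse f"] by (auto simp: local_units_def val_inverse)

lemma max_ideal_iff_val: "f \<in> max_ideal P \<longleftrightarrow> f = 0 \<or> val_at P f > 0"
  using mem_iff_val[of f] mem_iff_val[of "inverse f"] zero_mem
  by (cases "f = 0") (auto simp: max_ideal_def val_inverse)

lemma ex_val_eq: obtains t where "t \<noteq> 0" "val_at P t = n"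
proof -
  obtain t where t: "uniformizer P t" using ex_uniformizer by blast
  show thesis using that[of "t powi n"] val_eq[OF t units_one, of n] t
    by (auto simp: uniformizer_def)
qed

text \<open>Division by an element of value exactly \<open>n\<close> turns the bound into membership
  in \<open>P\<close>, which is closed under addition.\<close>

lemma val_add_ge:
  assumes "f \<noteq> 0" "g \<noteq> 0" "f + g \<noteq> 0" "n \<le> val_at P f" "n \<le> val_at P g"
  shows "n \<le> val_at P (f + g)"
proof -
  obtain t where t: "t \<noteq> 0" "val_at P t = n" using ex_val_eq .
  have "f / t \<in> P" "g / t \<in> P" using assms t by (auto simp: mem_iff_val val_divide)
  then have "(f + g) / t \<in> P" by (simp add: add_mem add_divide_distrib)
  then show ?thesis using assms t by (auto simp: mem_iff_val val_divide)
qed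

lemma val_uminus [simp]: "val_at P (- f) = val_at P f"
proof (cases "f = 0")
  case False
  have "2 * val_at P (- 1) = 0" using val_mult[of "-1" "-1"] by simp
  then show ?thesis using False val_mult[of "-1" f] by simp
qed simp

lemma val_add_strict:
  assumes "f \<noteq> 0" "g \<noteq> 0" "val_at P f < val_at P g"
  shows "f + g \<noteq> 0" "val_at P (f + g) = val_at P f"
proof -
  show nz: "f + g \<noteq> 0"
    using assms(3) by (metis add_eq_0_iff2 less_irrefl val_uminus)
  have "val_at P f \<le> val_at P (f + g)" using assms nz by (intro val_add_ge) auto
  \<comment> \<open>Otherwise \<open>f + g\<close> and \<open>- g\<close> would both have larger
    value than \<open>f\<close>, and then so would their sum, which is \<open>f\<close>.\<close>
  moreover have "\<not> val_at P f + 1 \<le> val_at P (f + g)"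
    using val_add_ge[of "f + g" "- g" "val_at P f + 1"] assms nz by auto
  ultimately show "val_at P (f + g) = val_at P f" by simp
qed

end

section \<open>Independence of the valuations at distinct points\<close>

lemma points_incomparable:
  assumes P: "P \<in> points emb" and Q: "Q \<in> points emb" and "P \<subseteq> Q"
  shows "P = Q"
proof (rule ccontr)
  assume "P \<noteq> Q"
  then obtain f where f: "f \<in> Q" "f \<notin> P" using assms(3) by blast
  then have "f \<noteq> 0" using zero_mem[OF P] by auto
  then have neg: "val_at P f < 0" using f mem_iff_val[OF P] by force
  \<comment> \<open>A discrete valuation ring is a maximal proper subring: \<open>f\<close> has a
    pole at \<open>P\<close>, so division by a high power of \<open>f\<close> brings
    \<open>x\<close> into \<open>P\<close>, and \<open>Q\<close> contains that power. Hence
    \<open>Q\<close> would be the whole field, although some element has value -1 at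
    \<open>Q\<close>.\<close>
  have "x \<in> Q" if "x \<noteq> 0" for x
  proof -
    define n where "n = nat \<bar>val_at P x\<bar>"
    have "val_at P (x / f ^ n) = val_at P x - int n * val_at P f"
      using that \<open>f \<noteq> 0\<close> by (simp add: val_divide[OF P] val_power[OF P])
    moreover have "int n * val_at P f \<le> int n * (- 1)"
      using neg by (intro mult_left_mono) auto
    ultimately have "val_at P (x / f ^ n) \<ge> 0"
      unfolding n_def by linarith
    then have "x / f ^ n \<in> P" using that \<open>f \<noteq> 0\<close> by (simp add: mem_iff_val[OF P])
    then have "x / f ^ n * f ^ n \<in> Q"
      using assms(3) f by (intro mult_mem[OF Q] power_mem[OF Q]) auto
    then show ?thesis using \<open>f \<noteq> 0\<close> by simp
  qed
  moreover obtain t where "t \<noteq> 0" "val_at Q t = - 1" using ex_val_eq[OF Q] .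
  ultimately show False using mem_iff_val[OF Q, of t] by auto
qed

lemma separate_two:
  assumes P: "P \<in> points emb" and Q: "Q \<in> points emb" and "P \<noteq> Q"
  obtains f where "f \<noteq> 0" "val_at P f > 0" "val_at Q f < 0"
proof -
  obtain f g where fg: "f \<in> P" "f \<notin> Q" "g \<in> Q" "g \<notin> P"
    using points_incomparable assms by blast
  then have nz: "f \<noteq> 0" "g \<noteq> 0" using zero_mem[OF P] zero_mem[OF Q] by auto
  then have "val_at P (f / g) > 0" "val_at Q (f / g) < 0"
    using fg by (auto simp: mem_iff_val[OF P] mem_iff_val[OF Q] val_divide[OF P] val_divide[OF Q])
  then show thesis using nz by (intro that[of "f / g"]) auto
qed

text \<open>Induction on \<open>S\<close>. If \<open>f\<close> has no pole at the new point
  \<open>R\<close>, a function \<open>z\<close> with a pole at \<open>R\<close> and a zero at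
  \<open>P\<close> is added to a high power of \<open>f\<close>: \<open>z\<close> dominates at
  \<open>R\<close>, the power dominates on \<open>S\<close>, and both vanish at
  \<open>P\<close>.\<close>

lemma separate_finite:
  assumes P: "P \<in> points emb" and "finite S" "S \<subseteq> points emb" "P \<notin> S"
  shows "\<exists>f. f \<noteq> 0 \<and> val_at P f > 0 \<and> (\<forall>Q\<in>S. val_at Q f < 0)"
  using assms(2-)
proof (induction S)
  case empty
  obtain t where "t \<noteq> 0" "val_at P t = 1" using ex_val_eq[OF P] .
  then show ?case by auto
next
  case (insert R S)
  then have R: "R \<in> points emb" "P \<noteq> R" by auto
  obtain f where f: "f \<noteq> 0" "val_at P f > 0" "\<And>Q. Q \<in> S \<Longrightarrow> val_at Q f < 0"
    using insert by auto
  show ?case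
  proof (cases "val_at R f < 0")
    case True
    then show ?thesis using f by auto
  next
    case False
    obtain z where z: "z \<noteq> 0" "val_at P z > 0" "val_at R z < 0"
      using separate_two[OF P R] .
    \<comment> \<open>Larger than every \<open>\<bar>val_at Q z\<bar>\<close> with \<open>Q\<close>
      in \<open>S\<close>, so that \<open>f ^ m\<close> has strictly smaller value than
      \<open>z\<close> there. The \<open>Suc\<close> makes the inequality strict.\<close>
    define m where "m = Suc (nat (\<Sum>Q\<in>S. \<bar>val_at Q z\<bar>))"
    have fm: "f ^ m \<noteq> 0" using f by simp
    have R': "z + f ^ m \<noteq> 0" "val_at R (z + f ^ m) < 0"
    proof -
      have "val_at R z < val_at R (f ^ m)"
        using False z f by (simp add: val_power[OF R(1)] order_less_le_trans)
      then show "z + f ^ m \<noteq> 0" "val_at R (z + f ^ m) < 0"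
        using val_add_strict[OF R(1) z(1) fm] z by auto
    qed
    have "1 * 1 \<le> int m * val_at P f" using f by (intro mult_mono) (auto simp: m_def)
    then have "val_at P (f ^ m) \<ge> 1" using f by (simp add: val_power[OF P])
    then have "val_at P (z + f ^ m) \<ge> 1"
      using z fm R' by (intro val_add_ge[OF P]) auto
    moreover have "val_at Q (z + f ^ m) < 0" if "Q \<in> S" for Q
    proof -
      have Q: "Q \<in> points emb" using that insert by auto
      have "\<bar>val_at Q z\<bar> \<le> (\<Sum>Q\<in>S. \<bar>val_at Q z\<bar>)"
        using that insert by (intro member_le_sum) auto
      then have "int m > \<bar>val_at Q z\<bar>" unfolding m_def by linarith
      moreover have "int m * val_at Q f \<le> int m * (- 1)"
        using f(3)[OF that] by (intro mult_left_mono) auto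
      ultimately have less: "val_at Q (f ^ m) < val_at Q z" and "val_at Q (f ^ m) < 0"
        using f by (auto simp: val_power[OF Q])
      then show ?thesis using val_add_strict[OF Q fm z(1) less] by (simp add: add.commute)
    qed
    ultimately show ?thesis using R' by (intro exI[of _ "z + f ^ m"]) auto
  qed
qed

lemma local_parameter:
  assumes P: "P \<in> points emb" and S: "finite S" "S \<subseteq> points emb" "P \<notin> S"
  obtains p where "p \<noteq> 0" "val_at P p = 1" "\<And>Q. Q \<in> S \<Longrightarrow> val_at Q p = 0"
proof -
  obtain f where f: "f \<noteq> 0" "val_at P f > 0" "\<And>Q. Q \<in> S \<Longrightarrow> val_at Q f < 0"
    using separate_finite[OF assms] by blast
  obtain t where t: "t \<noteq> 0" "val_at P t = 1" using ex_val_eq[OF P] .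
  define m where "m = Suc (Suc (nat (\<Sum>Q\<in>S. \<bar>val_at Q t\<bar>)))"
  \<comment> \<open>\<open>u = 1 / (1 + f)\<close> is close to 1 at \<open>P\<close> and close to 0 on \<open>S\<close>; take \<open>p = t u\<^sup>m + (1 - u)\<^sup>m\<close>.\<close>
  have fm: "f ^ m \<noteq> 0" using f by simp
  have P1: "1 + f \<noteq> 0" "val_at P (1 + f) = 0"
    using val_add_strict[OF P, of 1 f] f P by auto
  \<comment> \<open>The second \<open>Suc\<close> in \<open>m\<close> gives \<open>f ^ m\<close>
    value at least 2 at \<open>P\<close>, above the value 1 of \<open>t\<close>, so that
    \<open>t + f ^ m\<close> keeps the value 1.\<close>
  have "2 * 1 \<le> int m * val_at P f" using f by (intro mult_mono) (auto simp: m_def)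
  then have "val_at P t < val_at P (f ^ m)" using t f by (simp add: val_power[OF P])
  from val_add_strict[OF P t(1) fm this]
  have Pt: "t + f ^ m \<noteq> 0" "val_at P (t + f ^ m) = 1" using t by auto
  have "val_at Q ((t + f ^ m) / (1 + f) ^ m) = 0" if "Q \<in> S" for Q
  proof -
    have Q: "Q \<in> points emb" using that S by auto
    have "\<bar>val_at Q t\<bar> \<le> (\<Sum>Q\<in>S. \<bar>val_at Q t\<bar>)"
      using that S by (intro member_le_sum) auto
    then have "int m > \<bar>val_at Q t\<bar>" unfolding m_def by linarith
    moreover have "int m * val_at Q f \<le> int m * (- 1)"
      using f(3)[OF that] by (intro mult_left_mono) auto
    ultimately have less: "val_at Q (f ^ m) < val_at Q t"
      using f by (auto simp: val_power[OF Q])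
    \<comment> \<open>At \<open>Q\<close> the pole of \<open>f\<close> dominates:
      \<open>f ^ m\<close> outweighs \<open>t\<close>, and \<open>f\<close> outweighs 1. Numerator
      and denominator therefore have the same value \<open>int m * val_at Q f\<close>.\<close>
    have "val_at Q (t + f ^ m) = int m * val_at Q f"
      using val_add_strict(2)[OF Q fm t(1) less] f by (simp add: add.commute val_power[OF Q])
    moreover have "val_at Q (1 + f) = val_at Q f"
      using val_add_strict(2)[OF Q f(1), of 1] f(3)[OF that] Q by (simp add: add.commute)
    ultimately show ?thesis using P1 Pt by (simp add: val_divide[OF Q] val_power[OF Q])
  qed
  then show thesis using P1 Pt
    by (intro that[of "(t + f ^ m) / (1 + f) ^ m"]) (auto simp: val_divide[OF P] val_power[OF P])
qed

lemma val_prod: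
  assumes "P \<in> points emb" "finite A" "\<And>x. x \<in> A \<Longrightarrow> f x \<noteq> 0"
  shows "val_at P (\<Prod>x\<in>A. f x) = (\<Sum>x\<in>A. val_at P (f x))"
  using assms(2,3) by (induction A) (auto simp: val_mult[OF assms(1)] val_one[OF assms(1)])

text \<open>Each \<open>p P\<close> has value 1 at its own point and 0 at the rest of
  \<open>S\<close>, so a product of powers takes the prescribed values independently. Zeros and
  poles of \<open>h\<close> outside \<open>S\<close> are left uncontrolled.\<close>

lemma weak_approximation:
  assumes S: "finite S" "S \<subseteq> points emb"
  obtains h where "h \<noteq> 0" "\<And>P. P \<in> S \<Longrightarrow> val_at P h = n P"
proof -
  have "\<forall>P\<in>S. \<exists>p. p \<noteq> 0 \<and> val_at P p = 1 \<and> (\<forall>Q\<in>S - {P}. val_at Q p = 0)"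
  proof
    fix P assume P: "P \<in> S"
    obtain p where "p \<noteq> 0" "val_at P p = 1" "\<And>Q. Q \<in> S - {P} \<Longrightarrow> val_at Q p = 0"
    proof (rule local_parameter)
      show "P \<in> points emb" "finite (S - {P})" "S - {P} \<subseteq> points emb" "P \<notin> S - {P}"
        using P S by auto
    qed blast
    then show "\<exists>p. p \<noteq> 0 \<and> val_at P p = 1 \<and> (\<forall>Q\<in>S - {P}. val_at Q p = 0)" by blast
  qed
  then obtain p where p: "\<And>P. P \<in> S \<Longrightarrow> p P \<noteq> 0" "\<And>P. P \<in> S \<Longrightarrow> val_at P (p P) = 1"
      "\<And>P Q. P \<in> S \<Longrightarrow> Q \<in> S - {P} \<Longrightarrow> val_at Q (p P) = 0"
    by metis
  show thesis
  proof (rule that)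
    show "(\<Prod>P\<in>S. p P powi n P) \<noteq> 0" using S p by auto
    fix Q assume Q: "Q \<in> S"
    then have "val_at Q (\<Prod>P\<in>S. p P powi n P) = (\<Sum>P\<in>S. val_at Q (p P powi n P))"
      using S p by (intro val_prod) auto
    also have "\<dots> = (\<Sum>P\<in>S. if P = Q then n Q else 0)"
    proof (intro sum.cong refl)
      fix P assume "P \<in> S"
      then show "val_at Q (p P powi n P) = (if P = Q then n Q else 0)"
        using Q S p by (cases "P = Q") (simp_all add: val_powi subset_iff)
    qed
    also have "\<dots> = n Q" using Q S by simp
    finally show "val_at Q (\<Prod>P\<in>S. p P powi n P) = n Q" .
  qed
qed

end

section \<open>Norms from residue fields\<close>

context function_field
begin

context
  fixes P :: "'f set"
  assumes P: "P \<in> points emb"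
begin

lemma max_ideal_diff: "a \<in> max_ideal P \<Longrightarrow> b \<in> max_ideal P \<Longrightarrow> a - b \<in> max_ideal P"
  using val_add_ge[OF P, of a "- b" 1] by (cases "a = 0 \<or> b = 0 \<or> a = b")
    (auto simp: max_ideal_iff_val[OF P] val_uminus[OF P])

lemma max_ideal_zero: "0 \<in> max_ideal P"
  by (simp add: max_ideal_iff_val[OF P])

lemma max_ideal_add: "a \<in> max_ideal P \<Longrightarrow> b \<in> max_ideal P \<Longrightarrow> a + b \<in> max_ideal P"
  using max_ideal_diff[OF _ max_ideal_diff[OF max_ideal_zero], of a b] by simp

lemma max_ideal_mult: "a \<in> P \<Longrightarrow> b \<in> max_ideal P \<Longrightarrow> a * b \<in> max_ideal P"
  by (cases "a = 0 \<or> b = 0")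
    (auto simp: max_ideal_iff_val[OF P] val_mult[OF P] mem_iff_val[OF P])

lemma max_ideal_sum: "(\<And>i. i \<in> A \<Longrightarrow> g i \<in> max_ideal P) \<Longrightarrow> sum g A \<in> max_ideal P"
  by (induction A rule: infinite_finite_induct) (auto simp: max_ideal_zero max_ideal_add)

abbreviation scl :: "'k \<Rightarrow> 'f \<Rightarrow> 'f" where "scl \<equiv> \<lambda>c a. emb c * a"

text \<open>The matrix under the determinant in \<open>norm_at\<close>, with the basis as an
  explicit argument instead of a hidden choice.\<close>

definition mult_matrix :: "'f list \<Rightarrow> 'f \<Rightarrow> 'k mat" where
  "mult_matrix bs f =
     mat (length bs) (length bs) (\<lambda>(i, j). quot_coords scl (max_ideal P) bs (f * bs ! j) $ i)"

lemma mult_matrix_carrier: "mult_matrix bs f \<in> carrier_mat (length bs) (length bs)"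
  by (simp add: mult_matrix_def)

text \<open>Degree and norm choose the same basis. If there is none, the default degree 0 and the
  default norm 1 fit together: multiplicativity and the formula for constants hold in both
  cases.\<close>

lemma norm_at_cases:
  obtains "point_degree emb P = 0" "\<And>f. norm_at emb P f = 1"
  | bs where "quot_basis scl P (max_ideal P) bs" "point_degree emb P = length bs"
      "\<And>f. norm_at emb P f = det (mult_matrix bs f)"
proof (cases "\<exists>bs. quot_basis scl P (max_ideal P) bs")
  case False
  then show ?thesis
    by (intro that(1))
      (simp_all only: point_degree_def quot_dim_def norm_at_def Let_def if_False)
next
  case True
  show ?thesis
    using that(2)[OF someI_ex[OF True]] True
    by (simp add: point_degree_def quot_dim_def norm_at_def Let_def mult_matrix_def)
qed

context
  fixes bs :: "'f list"
  assumes bs: "quot_basis scl P (max_ideal P) bs"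
begin

lemma basis_mem: "i < length bs \<Longrightarrow> bs ! i \<in> P"
  using bs by (auto simp: quot_basis_def)

lemma coords:
  assumes "v \<in> P"
  shows "quot_coords scl (max_ideal P) bs v \<in> carrier_vec (length bs)"
    "v - lin_comb scl bs (quot_coords scl (max_ideal P) bs v) \<in> max_ideal P"
proof -
  have "\<exists>!c. c \<in> carrier_vec (length bs) \<and> v - lin_comb scl bs c \<in> max_ideal P"
    using bs assms by (auto simp: quot_basis_def)
  from theI'[OF this] show "quot_coords scl (max_ideal P) bs v \<in> carrier_vec (length bs)"
    "v - lin_comb scl bs (quot_coords scl (max_ideal P) bs v) \<in> max_ideal P"
    by (auto simp: quot_coords_def)
qed

lemma coords_eqI:
  assumes "v \<in> P" "c \<in> carrier_vec (length bs)" "v - lin_comb scl bs c \<in> max_ideal P"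
  shows "quot_coords scl (max_ideal P) bs v = c"
proof -
  have "\<exists>!c. c \<in> carrier_vec (length bs) \<and> v - lin_comb scl bs c \<in> max_ideal P"
    using bs assms by (auto simp: quot_basis_def)
  then show ?thesis using assms coords[OF assms(1)] by blast
qed

lemma coords_mult:
  assumes f: "f \<in> P" and v: "v \<in> P"
  shows "quot_coords scl (max_ideal P) bs (f * v) =
    mult_matrix bs f *\<^sub>v quot_coords scl (max_ideal P) bs v"
proof -
  define c where "c = quot_coords scl (max_ideal P) bs v"
  let ?n = "length bs"
  let ?m = "\<lambda>i j. mult_matrix bs f $$ (i, j)"
  note c = coords[OF v, folded c_def]
  have "f * v \<in> P" using f v by (rule mult_mem[OF P])
  have carrier: "mult_matrix bs f *\<^sub>v c \<in> carrier_vec ?n"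
    by (simp add: mult_matrix_def carrier_vecI)
  have col: "f * bs ! j - (\<Sum>i<?n. emb (?m i j) * bs ! i) \<in> max_ideal P" if "j < ?n" for j
    using coords(2)[OF mult_mem[OF P f basis_mem[OF that]]] that
    by (simp add: lin_comb_def mult_matrix_def)
  have entry: "(mult_matrix bs f *\<^sub>v c) $ i = (\<Sum>j<?n. ?m i j * c $ j)" if "i < ?n" for i
    using that c(1)
    by (auto simp: mult_matrix_def scalar_prod_def lessThan_atLeast0 intro!: sum.cong)
  have "lin_comb scl bs (mult_matrix bs f *\<^sub>v c) =
      (\<Sum>i<?n. \<Sum>j<?n. emb (c $ j) * (emb (?m i j) * bs ! i))"
    by (simp add: lin_comb_def entry hom_sum hom_mult sum_distrib_left sum_distrib_right mult_ac)
  also have "\<dots> = (\<Sum>j<?n. emb (c $ j) * (\<Sum>i<?n. emb (?m i j) * bs ! i))"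
    by (subst sum.swap) (simp add: sum_distrib_left)
  \<comment> \<open>The error splits into \<open>f\<close> times the error of \<open>v\<close> and a
    combination, with constant coefficients, of the errors of the columns. All of this stays in the
    maximal ideal.\<close>
  finally have "f * v - lin_comb scl bs (mult_matrix bs f *\<^sub>v c) =
      f * (v - lin_comb scl bs c) +
      (\<Sum>j<?n. emb (c $ j) * (f * bs ! j - (\<Sum>i<?n. emb (?m i j) * bs ! i)))"
    by (simp add: lin_comb_def algebra_simps sum_subtractf sum_distrib_left)
  also have "\<dots> \<in> max_ideal P"
    using f v col
    by (intro max_ideal_add max_ideal_mult max_ideal_sum c(2) emb_mem[OF P]) auto
  finally show ?thesis
    unfolding c_def[symmetric] using \<open>f * v \<in> P\<close> carrier by (intro coords_eqI)
qed

lemma mult_matrix_mult: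
  assumes f: "f \<in> P" and g: "g \<in> P"
  shows "mult_matrix bs (f * g) = mult_matrix bs f * mult_matrix bs g"
proof (rule eq_matI)
  fix i j
  assume "i < dim_row (mult_matrix bs f * mult_matrix bs g)"
    "j < dim_col (mult_matrix bs f * mult_matrix bs g)"
  then have ij: "i < length bs" "j < length bs" by (simp_all add: mult_matrix_def)
  have gj: "g * bs ! j \<in> P" using g ij by (intro mult_mem[OF P] basis_mem)
  have "col (mult_matrix bs g) j = quot_coords scl (max_ideal P) bs (g * bs ! j)"
    using ij coords(1)[OF gj] by (intro eq_vecI) (auto simp: mult_matrix_def)
  moreover have "mult_matrix bs (f * g) $$ (i, j) =
      quot_coords scl (max_ideal P) bs (f * (g * bs ! j)) $ i"
    using ij by (simp add: mult_matrix_def mult.assoc)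
  ultimately show "mult_matrix bs (f * g) $$ (i, j) = (mult_matrix bs f * mult_matrix bs g) $$ (i, j)"
    using ij by (simp add: coords_mult[OF f gj]) (simp add: mult_matrix_def)
qed (simp_all add: mult_matrix_def)

lemma mult_matrix_emb: "mult_matrix bs (emb c) = c \<cdot>\<^sub>m 1\<^sub>m (length bs)"
proof (rule eq_matI)
  fix i j
  assume "i < dim_row (c \<cdot>\<^sub>m 1\<^sub>m (length bs))" "j < dim_col (c \<cdot>\<^sub>m 1\<^sub>m (length bs))"
  then have ij: "i < length bs" "j < length bs" by simp_all
  have "quot_coords scl (max_ideal P) bs (emb c * bs ! j) = c \<cdot>\<^sub>v unit_vec (length bs) j"
  proof (rule coords_eqI)
    show "emb c * bs ! j \<in> P" using ij by (intro mult_mem[OF P] emb_mem[OF P] basis_mem)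
    have "lin_comb scl bs (c \<cdot>\<^sub>v unit_vec (length bs) j) =
        (\<Sum>i<length bs. if i = j then emb c * bs ! i else 0)"
      unfolding lin_comb_def using ij by (intro sum.cong) auto
    also have "\<dots> = emb c * bs ! j" using ij by simp
    finally show "emb c * bs ! j - lin_comb scl bs (c \<cdot>\<^sub>v unit_vec (length bs) j) \<in> max_ideal P"
      by (simp add: max_ideal_zero)
  qed simp
  then show "mult_matrix bs (emb c) $$ (i, j) = (c \<cdot>\<^sub>m 1\<^sub>m (length bs)) $$ (i, j)"
    using ij by (simp add: mult_matrix_def)
qed (simp_all add: mult_matrix_def)

end

lemma norm_mult:
  assumes "f \<in> P" "g \<in> P"
  shows "norm_at emb P (f * g) = norm_at emb P f * norm_at emb P g"
proof (cases rule: norm_at_cases)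
  case (2 bs)
  then show ?thesis
    using assms by (simp add: mult_matrix_mult det_mult[OF mult_matrix_carrier mult_matrix_carrier])
qed simp

text \<open>A constant acts on the residue field by a scalar matrix whose size is the degree; in the
  default case both sides are 1.\<close>

lemma norm_emb: "norm_at emb P (emb c) = c ^ point_degree emb P"
  by (cases rule: norm_at_cases) (auto simp: mult_matrix_emb)

lemma norm_one [simp]: "norm_at emb P 1 = 1"
  using norm_emb[of 1] by simp

lemma norm_unit_nonzero:
  assumes "u \<in> local_units P"
  shows "norm_at emb P u \<noteq> 0"
  using norm_mult[of u "inverse u"] assms by (auto simp: local_units_def)

lemma norm_divide:
  assumes "f \<in> local_units P" "g \<in> local_units P"
  shows "norm_at emb P (f / g) = norm_at emb P f / norm_at emb P g"
proof -
  have "f / g \<in> P" "g \<in> P" "g \<noteq> 0"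
    using assms units_mult[OF P assms(1) units_inverse[OF P assms(2)]]
    by (auto simp: local_units_def divide_inverse)
  then show ?thesis using norm_mult[of "f / g" g] norm_unit_nonzero[OF assms(2)] by (simp add: field_simps)
qed

end

text \<open>The list \<open>[1]\<close> is a basis of the residue field, which rules out the default
  degree 0. The basis chosen in \<open>point_degree\<close> may be another one, but it is not empty,
  since 1 is not in the maximal ideal.\<close>

lemma rational_point_degree_pos:
  assumes "rational_point emb P"
  shows "point_degree emb P > 0"
proof -
  have P: "P \<in> points emb" using assms by (simp add: rational_point_def)
  have "quot_basis (\<lambda>c a. emb c * a) P (max_ideal P) [1]"
    unfolding quot_basis_def
  proof (intro conjI ballI ex_ex1I)
    show "set [1] \<subseteq> P" using one_mem[OF P] by simp
  next
    fix v assume "v \<in> P"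
    then obtain c where "v - emb c \<in> max_ideal P" using assms by (auto simp: rational_point_def)
    then show "\<exists>d. d \<in> carrier_vec (length [1::'f]) \<and>
        v - lin_comb (\<lambda>c a. emb c * a) [1] d \<in> max_ideal P"
      by (intro exI[of _ "vec 1 (\<lambda>_. c)"]) (auto simp: lin_comb_def)
  next
    fix v d d'
    assume "d \<in> carrier_vec (length [1::'f]) \<and>
        v - lin_comb (\<lambda>c a. emb c * a) [1] d \<in> max_ideal P"
      and "d' \<in> carrier_vec (length [1::'f]) \<and>
        v - lin_comb (\<lambda>c a. emb c * a) [1] d' \<in> max_ideal P"
    then have d: "d \<in> carrier_vec 1" "d' \<in> carrier_vec 1"
      and "v - emb (d' $ 0) \<in> max_ideal P" "v - emb (d $ 0) \<in> max_ideal P"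
      by (auto simp: lin_comb_def)
    then have W: "emb (d $ 0 - d' $ 0) \<in> max_ideal P"
      using max_ideal_diff[OF P] by (fastforce simp: hom_minus)
    have "d $ 0 - d' $ 0 = 0"
    proof (rule ccontr)
      assume "d $ 0 - d' $ 0 \<noteq> 0"
      then show False using W emb_mem[OF P, of "inverse (d $ 0 - d' $ 0)"]
        by (auto simp: max_ideal_def hom_inverse)
    qed
    then show "d = d'" using d by (intro eq_vecI) auto
  qed
  then have ex: "\<exists>bs. quot_basis (\<lambda>c a. emb c * a) P (max_ideal P) bs" by blast
  define bs where "bs = (SOME bs. quot_basis (\<lambda>c a. emb c * a) P (max_ideal P) bs)"
  have basis: "quot_basis (\<lambda>c a. emb c * a) P (max_ideal P) bs"
    unfolding bs_def using ex by (rule someI_ex)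
  have "bs \<noteq> []"
  proof
    assume "bs = []"
    then have "1 \<in> max_ideal P"
      using basis one_mem[OF P] by (auto simp: quot_basis_def lin_comb_def)
    then show False using one_mem[OF P] by (simp add: max_ideal_def)
  qed
  moreover have "point_degree emb P = length bs"
    unfolding point_degree_def quot_dim_def if_P[OF ex] bs_def ..
  ultimately show ?thesis by simp
qed

end

section \<open>Divisors and norm spaces\<close>

lemma support_uminus [simp]: "support (- D) = support D"
  and support_add: "support (D + E) \<subseteq> support D \<union> support E"
  and support_diff: "support (D - E) \<subseteq> support D \<union> support E"
  by (auto simp: support_def)

text \<open>Common form of \<open>eval_div\<close>, of \<open>section_norm\<close> and of the
  change-of-frame factors in \<open>norm_space\<close>, with the local weights \<open>w\<close> left
  arbitrary.\<close>

definition div_prod :: "('f::field set \<Rightarrow> 'k::field) \<Rightarrow> ('f set \<Rightarrow> int) \<Rightarrow> 'k" where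
  "div_prod w D = (\<Prod>P\<in>support D. w P powi D P)"

lemma powi_sum:
  fixes c :: "'a::field"
  assumes "c \<noteq> 0"
  shows "c powi (\<Sum>x\<in>A. n x) = (\<Prod>x\<in>A. c powi n x)"
  using assms by (induction A rule: infinite_finite_induct) (auto simp: power_int_add)

lemma div_prod_superset:
  assumes "finite S" "support D \<subseteq> S"
  shows "div_prod w D = (\<Prod>P\<in>S. w P powi D P)"
  unfolding div_prod_def using assms by (intro prod.mono_neutral_left) (auto simp: support_def)

text \<open>Multiplicities may cancel in \<open>D + E\<close>, and this is where nonzero weights
  matter: \<open>0 powi 1 * 0 powi (- 1)\<close> is 0, while \<open>0 powi 0\<close> is 1.\<close>

lemma div_prod_add:
  assumes "finite (support D)" "finite (support E)"
    and nz: "\<And>P. P \<in> support D \<union> support E \<Longrightarrow> w P \<noteq> 0"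
  shows "div_prod w (D + E) = div_prod w D * div_prod w E"
proof -
  have "div_prod w A = (\<Prod>P\<in>support D \<union> support E. w P powi A P)" if "A \<in> {D, E, D + E}" for A
    using that assms support_add[of D E] by (intro div_prod_superset) auto
  then show ?thesis
    using nz by (simp add: power_int_add flip: prod.distrib)
qed

lemma div_prod_mult: "div_prod (\<lambda>P. v P * w P) D = div_prod v D * div_prod w D"
  by (simp add: div_prod_def power_int_mult_distrib prod.distrib)

lemma div_prod_cong: "(\<And>P. P \<in> support D \<Longrightarrow> v P = w P) \<Longrightarrow> div_prod v D = div_prod w D"
  by (simp add: div_prod_def)

lemma div_prod_nonzero:
  assumes "finite (support D)" "\<And>P. P \<in> support D \<Longrightarrow> w P \<noteq> 0"
  shows "div_prod w D \<noteq> 0"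
  using assms by (auto simp: div_prod_def)

lemma eval_div_eq: "eval_div emb f D = div_prod (\<lambda>P. norm_at emb P f) D"
  by (simp add: eval_div_def div_prod_def)

lemma section_norm_eq:
  "section_norm emb D M s \<sigma> =
    (if frame emb M \<sigma> then div_prod (\<lambda>P. norm_at emb P (s / \<sigma> P)) D else 0)"
  by (simp add: section_norm_def div_prod_def)

context function_field
begin

section \<open>Divisors, their degrees, and the divisors of functions and sections\<close>

lemma divisors_add: "D \<in> divisors emb \<Longrightarrow> E \<in> divisors emb \<Longrightarrow> D + E \<in> divisors emb"
  and divisors_diff: "D \<in> divisors emb \<Longrightarrow> E \<in> divisors emb \<Longrightarrow> D - E \<in> divisors emb"
  using support_add[of D E] support_diff[of D E]
  by (auto simp: divisors_def intro: finite_subset)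

lemma divisors_outside: "D \<in> divisors emb \<Longrightarrow> P \<notin> points emb \<Longrightarrow> D P = 0"
  by (auto simp: divisors_def support_def)

lemma div_degree_superset:
  assumes "finite S" "support D \<subseteq> S"
  shows "div_degree emb D = (\<Sum>P\<in>S. D P * int (point_degree emb P))"
  unfolding div_degree_def using assms by (intro sum.mono_neutral_left) (auto simp: support_def)

lemma div_degree_add:
  assumes "finite (support D)" "finite (support E)"
  shows "div_degree emb (D + E) = div_degree emb D + div_degree emb E"
proof -
  have "div_degree emb A = (\<Sum>P\<in>support D \<union> support E. A P * int (point_degree emb P))"
    if "A \<in> {D, E, D + E}" for A
    using that assms support_add[of D E] by (intro div_degree_superset) auto
  then show ?thesis by (simp add: distrib_right sum.distrib)
qed

lemma div_degree_diff:
  assumes "finite (support D)" "finite (support E)"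
  shows "div_degree emb (D - E) = div_degree emb D - div_degree emb E"
proof -
  have "div_degree emb (- E) = - div_degree emb E" by (simp add: div_degree_def sum_negf)
  then show ?thesis using div_degree_add[of D "- E"] assms by simp
qed

lemma divisors0_add:
  assumes "D \<in> divisors0 emb" "E \<in> divisors0 emb"
  shows "D + E \<in> divisors0 emb"
proof -
  have "finite (support D)" "finite (support E)"
    using assms by (auto simp: divisors0_def divisors_def)
  then show ?thesis using assms by (simp add: divisors0_def divisors_add div_degree_add)
qed

lemma fun_div_mult: "f \<noteq> 0 \<Longrightarrow> g \<noteq> 0 \<Longrightarrow> fun_div emb (f * g) = fun_div emb f + fun_div emb g"
  and fun_div_inverse: "f \<noteq> 0 \<Longrightarrow> fun_div emb (inverse f) = - fun_div emb f"
  and fun_div_divide: "f \<noteq> 0 \<Longrightarrow> g \<noteq> 0 \<Longrightarrow> fun_div emb (f / g) = fun_div emb f - fun_div emb g"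
  and fun_div_one: "fun_div emb 1 = 0"
  by (auto simp: fun_div_def val_mult val_inverse val_divide val_one)

lemma fun_div_zero_iff_unit:
  assumes "f \<noteq> 0" "P \<in> points emb"
  shows "fun_div emb f P = 0 \<longleftrightarrow> f \<in> local_units P"
  using assms by (simp add: fun_div_def unit_iff_val)

text \<open>Two generators of a stalk are multiples of each other by elements of \<open>P\<close>,
  so neither has the larger value. This makes \<open>section_div\<close> independent of the
  generator that it chooses.\<close>

lemma local_gen_unique:
  assumes P: "P \<in> points emb" and "local_gen M P g" "local_gen M P h"
  shows "val_at P g = val_at P h"
proof -
  have "g \<in> M P" "h \<in> M P" using assms one_mem[OF P] by (auto simp: local_gen_def image_iff)
  then have "g \<in> (\<lambda>a. h * a) ` P" "h \<in> (\<lambda>a. g * a) ` P" using assms by (simp_all add: local_gen_def)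
  then obtain a b where ab: "a \<in> P" "b \<in> P" "g = h * a" "h = g * b" by blast
  moreover have "g \<noteq> 0" "h \<noteq> 0" using assms by (auto simp: local_gen_def)
  ultimately have "val_at P g = val_at P h + val_at P a" "val_at P h = val_at P g + val_at P b"
      "val_at P a \<ge> 0" "val_at P b \<ge> 0"
    using P mem_iff_val[OF P] val_mult[OF P] by (metis mult_zero_right)+
  then show ?thesis by linarith
qed

lemma section_div_local_gen:
  assumes P: "P \<in> points emb" and g: "local_gen M P g" and "s \<noteq> 0"
  shows "section_div emb M s P = val_at P s - val_at P g"
proof -
  have S: "local_gen M P (SOME g. local_gen M P g)" using g by (rule someI)
  then have "(SOME g. local_gen M P g) \<noteq> 0" by (simp add: local_gen_def)
  then show ?thesis
    using P \<open>s \<noteq> 0\<close> local_gen_unique[OF P S g] by (simp add: section_div_def val_divide)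
qed

lemma local_gen_O_bundle_iff:
  assumes P: "P \<in> points emb"
  shows "local_gen (O_bundle E) P g \<longleftrightarrow> g \<noteq> 0 \<and> val_at P g = - E P"
proof -
  have *: "local_gen (O_bundle E) P h" if h: "h \<noteq> 0" "val_at P h = - E P" for h
  proof -
    have "a \<in> O_bundle E P \<longleftrightarrow> a / h \<in> P" for a
      using h P zero_mem[OF P] by (cases "a = 0") (auto simp: O_bundle_def mem_iff_val val_divide)
    moreover have "a / h \<in> P \<longleftrightarrow> a \<in> (\<lambda>b. h * b) ` P" for a
      using h(1) by (auto simp: image_iff intro: bexI[of _ "a / h"])
    ultimately show ?thesis using h by (auto simp: local_gen_def)
  qed
  obtain t where "t \<noteq> 0" "val_at P t = - E P" using ex_val_eq[OF P] .
  then have "val_at P g = - E P" if "local_gen (O_bundle E) P g"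
    using local_gen_unique[OF P that *[of t]] by simp
  then show ?thesis using *[of g] by (auto simp: local_gen_def)
qed

lemma section_div_O_bundle:
  assumes "E \<in> divisors emb" "s \<noteq> 0"
  shows "section_div emb (O_bundle E) s = fun_div emb s + E"
proof
  fix P
  show "section_div emb (O_bundle E) s P = (fun_div emb s + E) P"
  proof (cases "P \<in> points emb")
    case P: True
    obtain t where "t \<noteq> 0" "val_at P t = - E P" using ex_val_eq[OF P] .
    then show ?thesis
      using section_div_local_gen[OF P _ assms(2), of "O_bundle E" t] P
      by (simp add: local_gen_O_bundle_iff fun_div_def)
  next
    case False
    then show ?thesis using divisors_outside[OF assms(1)] by (simp add: section_div_def fun_div_def)
  qed
qed

lemma frame_O_bundle_iff:
  "frame emb (O_bundle E) \<sigma> \<longleftrightarrow> (\<forall>P\<in>points emb. \<sigma> P \<noteq> 0 \<and> val_at P (\<sigma> P) = - E P)"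
  by (simp add: frame_def local_gen_O_bundle_iff)

lemma ex_frame_O_bundle: "\<exists>\<sigma>. frame emb (O_bundle E) \<sigma>"
  unfolding frame_O_bundle_iff using ex_val_eq by (intro bchoice) blast

lemma frame_divide_unit:
  assumes "frame emb (O_bundle E) \<sigma>" "frame emb (O_bundle E) \<tau>" "P \<in> points emb"
  shows "\<tau> P / \<sigma> P \<in> local_units P"
  using assms by (auto simp: frame_O_bundle_iff unit_iff_val val_divide)

text \<open>Multiplication by \<open>f\<close> carries \<open>O_bundle (E + fun_div emb f)\<close>
  onto \<open>O_bundle E\<close>, so frames correspond under division by \<open>f\<close>, the
  substitution made in \<open>norm_map\<close>.\<close>

lemma frame_O_bundle_divide:
  assumes "f \<noteq> 0"
  shows "frame emb (O_bundle (E + fun_div emb f)) (\<lambda>P. \<tau> P / f) \<longleftrightarrow> frame emb (O_bundle E) \<tau>"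
proof -
  have "(\<tau> P / f \<noteq> 0 \<and> val_at P (\<tau> P / f) = - (E + fun_div emb f) P) \<longleftrightarrow>
      (\<tau> P \<noteq> 0 \<and> val_at P (\<tau> P) = - E P)" if "P \<in> points emb" for P
    using that assms by (cases "\<tau> P = 0") (auto simp: val_divide fun_div_def)
  then show ?thesis by (simp add: frame_O_bundle_iff)
qed

section \<open>Norm spaces and the triples of the torsor\<close>

lemma norm_spaceI:
  assumes "\<And>\<sigma>. \<not> frame emb M \<sigma> \<Longrightarrow> \<phi> \<sigma> = 0"
    and "\<And>\<sigma> \<tau>. frame emb M \<sigma> \<Longrightarrow> frame emb M \<tau> \<Longrightarrow>
      \<phi> \<sigma> = div_prod (\<lambda>P. norm_at emb P (\<tau> P / \<sigma> P)) D * \<phi> \<tau>"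
  shows "\<phi> \<in> norm_space emb D M"
  using assms unfolding norm_space_def div_prod_def by blast

lemma norm_space_outside: "\<phi> \<in> norm_space emb D M \<Longrightarrow> \<not> frame emb M \<sigma> \<Longrightarrow> \<phi> \<sigma> = 0"
  unfolding norm_space_def by blast

lemma norm_space_change_frame:
  assumes "\<phi> \<in> norm_space emb D M" "frame emb M \<sigma>" "frame emb M \<tau>"
  shows "\<phi> \<sigma> = div_prod (\<lambda>P. norm_at emb P (\<tau> P / \<sigma> P)) D * \<phi> \<tau>"
  using assms unfolding norm_space_def div_prod_def by blast

lemma triples_mult:
  assumes "(D, E, \<phi>) \<in> poincare_triples emb" "(D', E, \<psi>) \<in> poincare_triples emb"
  shows "(D + D', E, \<lambda>\<sigma>. \<phi> \<sigma> * \<psi> \<sigma>) \<in> poincare_triples emb"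
proof -
  have D: "D \<in> divisors0 emb" "D' \<in> divisors0 emb" and E: "E \<in> divisors0 emb"
    and n: "\<phi> \<in> norm_space emb D (O_bundle E)" "\<psi> \<in> norm_space emb D' (O_bundle E)"
    and nz: "\<phi> \<noteq> 0" "\<psi> \<noteq> 0"
    using assms by (auto simp: poincare_triples_def)
  have fin: "finite (support D)" "finite (support D')"
    and sub: "support D \<union> support D' \<subseteq> points emb"
    using D by (auto simp: divisors0_def divisors_def)
  have N: "(\<lambda>\<sigma>. \<phi> \<sigma> * \<psi> \<sigma>) \<in> norm_space emb (D + D') (O_bundle E)"
  proof (rule norm_spaceI)
    fix \<sigma> \<tau>
    assume \<sigma>\<tau>: "frame emb (O_bundle E) \<sigma>" "frame emb (O_bundle E) \<tau>"
    have "div_prod (\<lambda>P. norm_at emb P (\<tau> P / \<sigma> P)) (D + D') =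
        div_prod (\<lambda>P. norm_at emb P (\<tau> P / \<sigma> P)) D * div_prod (\<lambda>P. norm_at emb P (\<tau> P / \<sigma> P)) D'"
      using sub \<sigma>\<tau> by (intro div_prod_add fin norm_unit_nonzero frame_divide_unit) auto
    then show "\<phi> \<sigma> * \<psi> \<sigma> =
        div_prod (\<lambda>P. norm_at emb P (\<tau> P / \<sigma> P)) (D + D') * (\<phi> \<tau> * \<psi> \<tau>)"
      by (simp add: norm_space_change_frame[OF n(1) \<sigma>\<tau>] norm_space_change_frame[OF n(2) \<sigma>\<tau>])
  qed (simp add: norm_space_outside[OF n(1)])
  obtain \<sigma> \<tau> where nz': "\<phi> \<sigma> \<noteq> 0" "\<psi> \<tau> \<noteq> 0" using nz by (auto simp: fun_eq_iff)
  then have "frame emb (O_bundle E) \<sigma>" "frame emb (O_bundle E) \<tau>"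
    using norm_space_outside n by blast+
  \<comment> \<open>So far \<open>\<psi>\<close> is known to be nonzero only in the frame
    \<open>\<tau>\<close>. The change-of-frame law carries this to \<open>\<sigma>\<close>, where
    \<open>\<phi>\<close> is nonzero.\<close>
  from norm_space_change_frame[OF n(2) this(2,1)] have "\<phi> \<sigma> * \<psi> \<sigma> \<noteq> 0"
    using nz' by (metis mult_eq_0_iff)
  then have "(\<lambda>\<sigma>. \<phi> \<sigma> * \<psi> \<sigma>) \<noteq> 0" by (metis zero_fun_def)
  then show ?thesis using N D E by (simp add: poincare_triples_def divisors0_add)
qed

lemma triples_scale:
  assumes "(D, E, \<phi>) \<in> poincare_triples emb" "c \<noteq> 0"
  shows "(D, E, \<lambda>\<sigma>. c * \<phi> \<sigma>) \<in> poincare_triples emb"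
proof -
  have n: "\<phi> \<in> norm_space emb D (O_bundle E)" and "\<phi> \<noteq> 0"
    using assms by (auto simp: poincare_triples_def)
  have "(\<lambda>\<sigma>. c * \<phi> \<sigma>) \<in> norm_space emb D (O_bundle E)"
  proof (rule norm_spaceI)
    fix \<sigma> \<tau>
    assume "frame emb (O_bundle E) \<sigma>" "frame emb (O_bundle E) \<tau>"
    then show "c * \<phi> \<sigma> = div_prod (\<lambda>P. norm_at emb P (\<tau> P / \<sigma> P)) D * (c * \<phi> \<tau>)"
      using norm_space_change_frame[OF n, of \<sigma> \<tau>] by simp
  qed (simp add: norm_space_outside[OF n])
  moreover have "(\<lambda>\<sigma>. c * \<phi> \<sigma>) \<noteq> 0" using \<open>\<phi> \<noteq> 0\<close> assms(2) by (auto simp: fun_eq_iff)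
  ultimately show ?thesis using assms by (simp add: poincare_triples_def)
qed

text \<open>The norm space is one-dimensional: the change-of-frame law determines a vector by its
  coordinate in a single frame, and \<open>c\<close> is the ratio of two such coordinates.\<close>

lemma triples_proportional:
  assumes "(D, E, \<phi>) \<in> poincare_triples emb" "(D, E, \<psi>) \<in> poincare_triples emb"
  obtains c where "c \<noteq> 0" "\<psi> = (\<lambda>\<sigma>. c * \<phi> \<sigma>)"
proof -
  have n: "\<phi> \<in> norm_space emb D (O_bundle E)" "\<psi> \<in> norm_space emb D (O_bundle E)"
    and nz: "\<phi> \<noteq> 0" "\<psi> \<noteq> 0"
    using assms by (auto simp: poincare_triples_def)
  obtain \<tau> where \<tau>: "\<phi> \<tau> \<noteq> 0" using nz by (auto simp: fun_eq_iff)
  then have F: "frame emb (O_bundle E) \<tau>" using norm_space_outside n by blast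
  have eq: "\<psi> = (\<lambda>\<sigma>. (\<psi> \<tau> / \<phi> \<tau>) * \<phi> \<sigma>)"
  proof
    fix \<sigma>
    show "\<psi> \<sigma> = (\<psi> \<tau> / \<phi> \<tau>) * \<phi> \<sigma>"
    proof (cases "frame emb (O_bundle E) \<sigma>")
      case True
      then have "\<phi> \<sigma> = div_prod (\<lambda>P. norm_at emb P (\<tau> P / \<sigma> P)) D * \<phi> \<tau>"
          "\<psi> \<sigma> = div_prod (\<lambda>P. norm_at emb P (\<tau> P / \<sigma> P)) D * \<psi> \<tau>"
        using n F norm_space_change_frame by blast+
      then show ?thesis using \<tau> by simp
    next
      case False
      then show ?thesis using norm_space_outside[OF n(1)] norm_space_outside[OF n(2)] by simp
    qed
  qed
  moreover have "\<psi> \<tau> / \<phi> \<tau> \<noteq> 0"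
  proof
    assume "\<psi> \<tau> / \<phi> \<tau> = 0"
    then have "\<psi> \<sigma> = 0" for \<sigma> by (subst eq) auto
    then show False using nz by (simp add: fun_eq_iff)
  qed
  ultimately show thesis using that by blast
qed

lemma section_norm_units:
  assumes D: "D \<in> divisors emb" and E: "E \<in> divisors emb" and s: "s \<noteq> 0"
    and disj: "disjoint_div (section_div emb (O_bundle E) s) D"
    and \<sigma>: "frame emb (O_bundle E) \<sigma>" and P: "P \<in> support D"
  shows "P \<in> points emb" "s / \<sigma> P \<in> local_units P"
proof -
  show P': "P \<in> points emb" using D P by (auto simp: divisors_def)
  have "section_div emb (O_bundle E) s P = 0"
    using disj P by (auto simp: disjoint_div_def support_def)
  then show "s / \<sigma> P \<in> local_units P"
    using \<sigma> s E P' by (auto simp: section_div_O_bundle frame_O_bundle_iff unit_iff_val val_divide fun_div_def)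
qed

text \<open>Since the divisor of \<open>s\<close> avoids \<open>D\<close>, the quotients
  \<open>s / \<sigma> P\<close> are units along \<open>D\<close>. Multiplicativity of the local
  norms then gives the change-of-frame law, and no factor vanishes.\<close>

lemma section_norm_triple:
  assumes D: "D \<in> divisors0 emb" and E: "E \<in> divisors0 emb" and s: "s \<noteq> 0"
    and disj: "disjoint_div (section_div emb (O_bundle E) s) D"
  shows "(D, E, section_norm emb D (O_bundle E) s) \<in> poincare_triples emb"
proof -
  have D': "D \<in> divisors emb" and E': "E \<in> divisors emb" using D E by (auto simp: divisors0_def)
  note units = section_norm_units[OF D' E' s disj]
  have "section_norm emb D (O_bundle E) s \<sigma> =
      div_prod (\<lambda>P. norm_at emb P (\<tau> P / \<sigma> P)) D * section_norm emb D (O_bundle E) s \<tau>"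
    if \<sigma>: "frame emb (O_bundle E) \<sigma>" and \<tau>: "frame emb (O_bundle E) \<tau>" for \<sigma> \<tau>
  proof -
    have "norm_at emb P (s / \<sigma> P) = norm_at emb P (\<tau> P / \<sigma> P) * norm_at emb P (s / \<tau> P)"
      if P: "P \<in> support D" for P
    proof -
      have "\<tau> P \<noteq> 0" using \<tau> units(1)[OF \<sigma> P] by (simp add: frame_O_bundle_iff)
      then have "s / \<sigma> P = (\<tau> P / \<sigma> P) * (s / \<tau> P)" by simp
      then show ?thesis
        using units(2)[OF \<tau> P] frame_divide_unit[OF \<sigma> \<tau> units(1)[OF \<sigma> P]] units(1)[OF \<sigma> P]
        by (simp only: norm_mult local_units_def mem_Collect_eq)
    qed
    then show ?thesis
      using \<sigma> \<tau> by (simp add: section_norm_eq cong: div_prod_cong flip: div_prod_mult)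
  qed
  then have "section_norm emb D (O_bundle E) s \<in> norm_space emb D (O_bundle E)"
    by (intro norm_spaceI) (simp add: section_norm_eq)
  moreover obtain \<sigma> where \<sigma>: "frame emb (O_bundle E) \<sigma>" using ex_frame_O_bundle by blast
  have "div_prod (\<lambda>P. norm_at emb P (s / \<sigma> P)) D \<noteq> 0"
  proof (rule div_prod_nonzero)
    show "finite (support D)" using D' by (simp add: divisors_def)
    show "norm_at emb P (s / \<sigma> P) \<noteq> 0" if "P \<in> support D" for P
      using norm_unit_nonzero[OF units[OF \<sigma> that]] .
  qed
  then have "section_norm emb D (O_bundle E) s \<sigma> \<noteq> 0"
    using \<sigma> by (simp add: section_norm_eq)
  then have "section_norm emb D (O_bundle E) s \<noteq> 0" by (metis zero_fun_def)
  ultimately show ?thesis using D E by (simp add: poincare_triples_def)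
qed

text \<open>Disjointness keeps the weights nonzero on both supports, so \<open>div_prod_add\<close>
  applies even where \<open>D\<close> and \<open>D'\<close> cancel.\<close>

lemma section_norm_add:
  assumes D: "D \<in> divisors emb" "D' \<in> divisors emb" and E: "E \<in> divisors emb" and s: "s \<noteq> 0"
    and disj: "disjoint_div (section_div emb (O_bundle E) s) D"
      "disjoint_div (section_div emb (O_bundle E) s) D'"
  shows "section_norm emb (D + D') (O_bundle E) s =
    (\<lambda>\<sigma>. section_norm emb D (O_bundle E) s \<sigma> * section_norm emb D' (O_bundle E) s \<sigma>)"
proof
  fix \<sigma>
  show "section_norm emb (D + D') (O_bundle E) s \<sigma> =
    section_norm emb D (O_bundle E) s \<sigma> * section_norm emb D' (O_bundle E) s \<sigma>"
  proof (cases "frame emb (O_bundle E) \<sigma>")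
    case True
    have "norm_at emb P (s / \<sigma> P) \<noteq> 0" if "P \<in> support D \<union> support D'" for P
      using that section_norm_units[OF D(1) E s disj(1) True] section_norm_units[OF D(2) E s disj(2) True]
        norm_unit_nonzero by blast
    then have "div_prod (\<lambda>P. norm_at emb P (s / \<sigma> P)) (D + D') =
        div_prod (\<lambda>P. norm_at emb P (s / \<sigma> P)) D * div_prod (\<lambda>P. norm_at emb P (s / \<sigma> P)) D'"
      using D by (intro div_prod_add) (auto simp: divisors_def)
    then show ?thesis using True by (simp add: section_norm_eq)
  qed (simp add: section_norm_eq)
qed

lemma norm_map_norm_map:
  "norm_map g (norm_map f \<phi>) = norm_map (f * g) \<phi>"
  by (rule ext) (simp add: norm_map_def mult.commute)

lemma norm_map_triple:
  assumes "f \<noteq> 0" "(D, E + fun_div emb f, \<phi>) \<in> poincare_triples emb" "E \<in> divisors0 emb"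
  shows "(D, E, norm_map f \<phi>) \<in> poincare_triples emb"
proof -
  have n: "\<phi> \<in> norm_space emb D (O_bundle (E + fun_div emb f))" and "\<phi> \<noteq> 0" and D: "D \<in> divisors0 emb"
    using assms by (auto simp: poincare_triples_def)
  have F: "frame emb (O_bundle (E + fun_div emb f)) (\<lambda>P. \<tau> P / f) \<longleftrightarrow> frame emb (O_bundle E) \<tau>" for \<tau>
    using frame_O_bundle_divide[OF assms(1)] .
  have "\<phi> (\<lambda>P. \<sigma> P / f) = div_prod (\<lambda>P. norm_at emb P (\<tau> P / \<sigma> P)) D * \<phi> (\<lambda>P. \<tau> P / f)"
    if "frame emb (O_bundle E) \<sigma>" "frame emb (O_bundle E) \<tau>" for \<sigma> \<tau>
  proof -
    \<comment> \<open>The function \<open>f\<close> cancels in the quotient of the two divided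
      frames, so the transition factor is the one between \<open>\<sigma>\<close> and
      \<open>\<tau>\<close>.\<close>
    have "\<phi> (\<lambda>P. \<sigma> P / f) =
        div_prod (\<lambda>P. norm_at emb P ((\<tau> P / f) / (\<sigma> P / f))) D * \<phi> (\<lambda>P. \<tau> P / f)"
      using that F by (intro norm_space_change_frame[OF n]) auto
    then show ?thesis using assms(1) by simp
  qed
  note change = this
  have "norm_map f \<phi> \<in> norm_space emb D (O_bundle E)"
    unfolding norm_map_def
  proof (rule norm_spaceI)
    show "\<phi> (\<lambda>P. \<sigma> P / f) = 0" if "\<not> frame emb (O_bundle E) \<sigma>" for \<sigma>
      using that F by (intro norm_space_outside[OF n]) simp
  qed (rule change)
  moreover have "norm_map f \<phi> \<noteq> 0"
  proof
    assume 0: "norm_map f \<phi> = 0"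
    have "\<phi> \<sigma> = 0" for \<sigma>
    proof -
      have "norm_map f \<phi> (\<lambda>P. \<sigma> P * f) = 0" using 0 by (simp add: zero_fun_def)
      then show ?thesis using assms(1) by (simp add: norm_map_def)
    qed
    then show False using \<open>\<phi> \<noteq> 0\<close> by (simp add: fun_eq_iff)
  qed
  ultimately show ?thesis using assms D by (simp add: poincare_triples_def)
qed

end

text \<open>The global input. The two conditions on principal divisors are obtained from a line
  bundle of nonzero degree in \<open>complete_curve_of_degree\<close>; the rational point serves to
  show that functions without zeros and poles are constant.\<close>

locale complete_curve = function_field emb for emb :: "'k::field \<Rightarrow> 'f::field" +
  assumes finite_fun_div: "f \<noteq> 0 \<Longrightarrow> finite (support (fun_div emb f))"
    and degree_fun_div: "f \<noteq> 0 \<Longrightarrow> div_degree emb (fun_div emb f) = 0"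
    and ex_rational_point: "\<exists>P. rational_point emb P"
begin

lemma fun_div_divisors0: "f \<noteq> 0 \<Longrightarrow> fun_div emb f \<in> divisors0 emb"
  using finite_fun_div degree_fun_div
  by (auto simp: divisors0_def divisors_def support_def fun_div_def split: if_splits)

text \<open>Let \<open>c\<close> be the value of \<open>f\<close> at a rational point. If
  \<open>f - emb c\<close> were nonzero, it would be regular everywhere and vanish at that point, so
  its divisor would have positive degree.\<close>

lemma fun_div_zero_constant:
  assumes f: "f \<noteq> 0" "fun_div emb f = 0"
  obtains c where "f = emb c"
proof -
  obtain P where rat: "rational_point emb P" using ex_rational_point by blast
  then have P: "P \<in> points emb" by (simp add: rational_point_def)
  have mem: "f \<in> Q" if "Q \<in> points emb" for Q
    using fun_div_zero_iff_unit[OF f(1) that] f(2) by (simp add: local_units_def)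
  obtain c where c: "f - emb c \<in> max_ideal P"
    using rat mem[OF P] by (auto simp: rational_point_def)
  have "f - emb c = 0"
  proof (rule ccontr)
    assume nz: "f - emb c \<noteq> 0"
    let ?D = "fun_div emb (f - emb c)"
    have nonneg: "?D Q \<ge> 0" for Q
      using nz mem emb_mem diff_mem mem_iff_val[of Q "f - emb c"] by (auto simp: fun_div_def)
    have pos: "?D P > 0" using c nz P by (simp add: fun_div_def max_ideal_iff_val)
    have "0 < ?D P * int (point_degree emb P)"
      using pos rational_point_degree_pos[OF rat] by simp
    also have "\<dots> \<le> div_degree emb ?D"
      unfolding div_degree_def using finite_fun_div[OF nz] pos nonneg
      by (intro member_le_sum) (auto simp: support_def)
    finally show False using degree_fun_div[OF nz] by simp
  qed
  then show thesis using that[of c] by simp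
qed

text \<open>Such an \<open>f\<close> is a constant \<open>c\<close>, which acts on norms along
  \<open>D\<close> through \<open>c powi div_degree emb D\<close>, and \<open>D\<close> has degree
  0.\<close>

lemma norm_map_trivial:
  assumes f: "f \<noteq> 0" "fun_div emb f = 0" and t: "(D, E, \<phi>) \<in> poincare_triples emb"
  shows "norm_map f \<phi> = \<phi>"
proof
  fix \<tau>
  obtain c where c: "f = emb c" using fun_div_zero_constant[OF f] .
  then have "c \<noteq> 0" using f by auto
  have n: "\<phi> \<in> norm_space emb D (O_bundle E)" and D: "D \<in> divisors0 emb"
    using t by (auto simp: poincare_triples_def)
  have F: "frame emb (O_bundle E) (\<lambda>P. \<tau> P / f) \<longleftrightarrow> frame emb (O_bundle E) \<tau>"
    using frame_O_bundle_divide[OF f(1), of E] f(2) by simp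
  show "norm_map f \<phi> \<tau> = \<phi> \<tau>"
  proof (cases "frame emb (O_bundle E) \<tau>")
    case True
    then have "norm_map f \<phi> \<tau> = div_prod (\<lambda>P. norm_at emb P (\<tau> P / (\<tau> P / f))) D * \<phi> \<tau>"
      unfolding norm_map_def using F by (intro norm_space_change_frame[OF n]) auto
    also have "div_prod (\<lambda>P. norm_at emb P (\<tau> P / (\<tau> P / f))) D =
        (\<Prod>P\<in>support D. c powi (D P * int (point_degree emb P)))"
      unfolding div_prod_def
    proof (intro prod.cong refl)
      fix P assume "P \<in> support D"
      then have P: "P \<in> points emb" using D by (auto simp: divisors0_def divisors_def)
      then have "\<tau> P \<noteq> 0" using True by (simp add: frame_O_bundle_iff)
      then show "norm_at emb P (\<tau> P / (\<tau> P / f)) powi D P = c powi (D P * int (point_degree emb P))"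
        using f c P by (simp add: norm_emb power_int_power mult.commute)
    qed
    also have "\<dots> = c powi div_degree emb D"
      unfolding div_degree_def using \<open>c \<noteq> 0\<close> by (simp add: powi_sum)
    finally show ?thesis using D by (simp add: divisors0_def)
  next
    case False
    then show ?thesis using norm_space_outside[OF n] F by (simp add: norm_map_def)
  qed
qed

end

section \<open>The left group law is well defined\<close>

context complete_curve
begin

abbreviation identified (infix "\<sim>\<^sub>P" 50) where
  "identified \<equiv> equivclp (identification emb)"

lemma section_div_divisors:
  assumes "E \<in> divisors0 emb" "s \<noteq> 0"
  shows "section_div emb (O_bundle E) s \<in> divisors emb"
  using assms fun_div_divisors0[of s] by (simp add: divisors0_def section_div_O_bundle divisors_add)

lemma eval_div_nonzero:
  assumes f: "f \<noteq> 0" and A: "A \<in> divisors emb" and disj: "disjoint_div A (fun_div emb f)"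
  shows "eval_div emb f A \<noteq> 0"
  unfolding eval_div_eq
proof (rule div_prod_nonzero)
  show "finite (support A)" using A by (simp add: divisors_def)
  fix P assume "P \<in> support A"
  then have P: "P \<in> points emb" "fun_div emb f P = 0"
    using A disj by (auto simp: divisors_def disjoint_div_def support_def)
  then show "norm_at emb P f \<noteq> 0"
    using f by (intro norm_unit_nonzero) (auto simp flip: fun_div_zero_iff_unit)
qed

lemma disjoint_div_add: "disjoint_div A D \<Longrightarrow> disjoint_div A D' \<Longrightarrow> disjoint_div A (D + D')"
  using support_add[of D D'] by (auto simp: disjoint_div_def)

text \<open>For \<open>change_E\<close> membership is a premise. For \<open>change_D\<close> it
  follows, because disjointness makes the section norms and the value of \<open>f\<close>
  nonzero.\<close>

lemma identification_triples:
  assumes "identification emb t t'"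
  shows "t \<in> poincare_triples emb \<and> t' \<in> poincare_triples emb"
  using assms
proof cases
  case (change_D f s c D E)
  let ?A = "section_div emb (O_bundle E) s"
  have "eval_div emb f ?A \<noteq> 0"
    using change_D by (intro eval_div_nonzero section_div_divisors) auto
  then have "(D, E, \<lambda>\<sigma>. (c * eval_div emb f ?A) * section_norm emb D (O_bundle E) s \<sigma>) \<in> poincare_triples emb"
    using change_D by (intro triples_scale section_norm_triple) auto
  moreover have "(D + fun_div emb f, E, \<lambda>\<sigma>. c * section_norm emb (D + fun_div emb f) (O_bundle E) s \<sigma>)
      \<in> poincare_triples emb"
    using change_D by (intro triples_scale section_norm_triple disjoint_div_add) auto
  ultimately show ?thesis using change_D by (simp add: mult.assoc)
qed simp

lemma identified_triples:
  assumes "t \<sim>\<^sub>P t'" "t \<in> poincare_triples emb"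
  shows "t' \<in> poincare_triples emb"
  using assms by (induction) (auto dest: identification_triples)

text \<open>By one-dimensionality \<open>\<psi>\<close> is a multiple of the norm of the same
  section \<open>s\<close> along \<open>B\<close>. Both products are then multiples of norms of
  \<open>s\<close>, and \<open>change_D\<close> applies to \<open>D + B\<close>; its factor, the
  value of \<open>f\<close> on the divisor of \<open>s\<close>, is the same as for
  \<open>D\<close>.\<close>

lemma change_D_mult:
  assumes f: "f \<noteq> 0" and s: "s \<noteq> 0" and c: "c \<noteq> 0"
    and D: "D \<in> divisors0 emb" and E: "E \<in> divisors0 emb"
    and disj: "disjoint_div (section_div emb (O_bundle E) s) D"
      "disjoint_div (section_div emb (O_bundle E) s) (fun_div emb f)"
      "disjoint_div (section_div emb (O_bundle E) s) B"
    and B: "(B, E, \<psi>) \<in> poincare_triples emb"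
  shows "identification emb
    (D + fun_div emb f + B, E, \<lambda>\<sigma>. c * section_norm emb (D + fun_div emb f) (O_bundle E) s \<sigma> * \<psi> \<sigma>)
    (D + B, E, \<lambda>\<sigma>. c * (eval_div emb f (section_div emb (O_bundle E) s) *
      section_norm emb D (O_bundle E) s \<sigma>) * \<psi> \<sigma>)"
proof -
  have B': "B \<in> divisors0 emb" using B by (simp add: poincare_triples_def)
  note Df = divisors0_add[OF D fun_div_divisors0[OF f]]
  have div: "D \<in> divisors emb" "D + fun_div emb f \<in> divisors emb" "B \<in> divisors emb" "E \<in> divisors emb"
    using D Df B' E by (auto simp: divisors0_def)
  obtain d where d: "d \<noteq> 0" "\<psi> = (\<lambda>\<sigma>. d * section_norm emb B (O_bundle E) s \<sigma>)"
    using triples_proportional[OF section_norm_triple[OF B' E s disj(3)] B] .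
  have "identification emb
    (D + B + fun_div emb f, E, \<lambda>\<sigma>. (c * d) * section_norm emb (D + B + fun_div emb f) (O_bundle E) s \<sigma>)
    (D + B, E, \<lambda>\<sigma>. (c * d) * (eval_div emb f (section_div emb (O_bundle E) s) *
      section_norm emb (D + B) (O_bundle E) s \<sigma>))"
    using f s c d D E B' disj
    by (intro change_D) (auto intro!: divisors0_add fun_div_divisors0 disjoint_div_add)
  moreover have "D + B + fun_div emb f = D + fun_div emb f + B" by (simp add: ac_simps)
  ultimately show ?thesis
    using section_norm_add[OF div(1,3,4) s disj(1,3)]
      section_norm_add[OF div(2,3,4) s disjoint_div_add[OF disj(1,2)] disj(3)]
    by (simp add: d(2) mult_ac)
qed

text \<open>
  \<open>S\<close> contains the supports of the divisors of the sections used in the identifications that link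
  the two triples; \<open>f\<close> is the product of the functions by which these change the second divisor.
\<close>

fun translates ::
    "('f set \<Rightarrow> int) \<times> ('f set \<Rightarrow> int) \<times> (('f set \<Rightarrow> 'f) \<Rightarrow> 'k) \<Rightarrow>
     ('f set \<Rightarrow> int) \<times> ('f set \<Rightarrow> int) \<times> (('f set \<Rightarrow> 'f) \<Rightarrow> 'k) \<Rightarrow> bool" where
  "translates (D, E, \<phi>) (D', E', \<phi>') \<longleftrightarrow> (\<exists>f S. f \<noteq> 0 \<and> E = E' + fun_div emb f \<and> finite S \<and>
     (\<forall>B \<psi>. (B, E, \<psi>) \<in> poincare_triples emb \<longrightarrow> support B \<inter> S = {} \<longrightarrow>
       (D + B, E, \<lambda>\<sigma>. \<phi> \<sigma> * \<psi> \<sigma>) \<sim>\<^sub>P (D' + B, E', \<lambda>\<sigma>. \<phi>' \<sigma> * norm_map f \<psi> \<sigma>)))"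

lemma norm_map_one [simp]: "norm_map 1 \<phi> = \<phi>"
  by (rule ext) (simp add: norm_map_def)

lemma translates_refl: "translates t t"
proof -
  obtain D E \<phi> where t: "t = (D, E, \<phi>)" by (cases t)
  show ?thesis unfolding t translates.simps
    by (intro exI[of _ 1] exI[of _ "{}"]) (auto simp: fun_div_one)
qed

text \<open>The functions multiply and the exceptional sets unite; the intermediate factor over
  \<open>E'\<close> is \<open>norm_map f \<psi>\<close>.\<close>

lemma translates_trans:
  assumes "translates t t'" "translates t' t''" "t'' \<in> poincare_triples emb" "t' \<in> poincare_triples emb"
  shows "translates t t''"
proof -
  obtain D E \<phi> D' E' \<phi>' D'' E'' \<phi>''
    where t: "t = (D, E, \<phi>)" "t' = (D', E', \<phi>')" "t'' = (D'', E'', \<phi>'')" by (cases t, cases t', cases t'')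
  have E': "E' \<in> divisors0 emb" "E'' \<in> divisors0 emb"
    using assms t by (auto simp: poincare_triples_def)
  obtain f S where f: "f \<noteq> 0" "E = E' + fun_div emb f" "finite S"
    and fS: "\<And>B \<psi>. (B, E, \<psi>) \<in> poincare_triples emb \<Longrightarrow> support B \<inter> S = {} \<Longrightarrow>
       (D + B, E, \<lambda>\<sigma>. \<phi> \<sigma> * \<psi> \<sigma>) \<sim>\<^sub>P (D' + B, E', \<lambda>\<sigma>. \<phi>' \<sigma> * norm_map f \<psi> \<sigma>)"
    using assms(1) unfolding t translates.simps by blast
  obtain g R where g: "g \<noteq> 0" "E' = E'' + fun_div emb g" "finite R"
    and gR: "\<And>B \<psi>. (B, E', \<psi>) \<in> poincare_triples emb \<Longrightarrow> support B \<inter> R = {} \<Longrightarrow>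
       (D' + B, E', \<lambda>\<sigma>. \<phi>' \<sigma> * \<psi> \<sigma>) \<sim>\<^sub>P (D'' + B, E'', \<lambda>\<sigma>. \<phi>'' \<sigma> * norm_map g \<psi> \<sigma>)"
    using assms(2) unfolding t translates.simps by blast
  have "(D + B, E, \<lambda>\<sigma>. \<phi> \<sigma> * \<psi> \<sigma>) \<sim>\<^sub>P (D'' + B, E'', \<lambda>\<sigma>. \<phi>'' \<sigma> * norm_map (f * g) \<psi> \<sigma>)"
    if B: "(B, E, \<psi>) \<in> poincare_triples emb" "support B \<inter> (S \<union> R) = {}" for B \<psi>
  proof -
    have "(B, E', norm_map f \<psi>) \<in> poincare_triples emb"
      using B f E' by (intro norm_map_triple) auto
    from gR[OF this] fS[OF B(1)] B(2) show ?thesis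
      by (auto simp: norm_map_norm_map intro: equivclp_trans)
  qed
  moreover have "E = E'' + fun_div emb (f * g)" using f g by (simp add: fun_div_mult ac_simps)
  moreover have "f * g \<noteq> 0" "finite (S \<union> R)" using f g by auto
  ultimately show ?thesis unfolding t translates.simps by blast
qed

lemma translates_sym:
  assumes "translates t t'" "t \<in> poincare_triples emb"
  shows "translates t' t"
proof -
  obtain D E \<phi> D' E' \<phi>' where t: "t = (D, E, \<phi>)" "t' = (D', E', \<phi>')" by (cases t, cases t')
  have E: "E \<in> divisors0 emb" using assms t by (auto simp: poincare_triples_def)
  obtain f S where f: "f \<noteq> 0" "E = E' + fun_div emb f" "finite S"
    and fS: "\<And>B \<psi>. (B, E, \<psi>) \<in> poincare_triples emb \<Longrightarrow> support B \<inter> S = {} \<Longrightarrow>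
       (D + B, E, \<lambda>\<sigma>. \<phi> \<sigma> * \<psi> \<sigma>) \<sim>\<^sub>P (D' + B, E', \<lambda>\<sigma>. \<phi>' \<sigma> * norm_map f \<psi> \<sigma>)"
    using assms(1) unfolding t translates.simps by blast
  have E': "E' = E + fun_div emb (inverse f)" using f by (simp add: fun_div_inverse)
  have "(D' + B, E', \<lambda>\<sigma>. \<phi>' \<sigma> * \<psi> \<sigma>) \<sim>\<^sub>P (D + B, E, \<lambda>\<sigma>. \<phi> \<sigma> * norm_map (inverse f) \<psi> \<sigma>)"
    if B: "(B, E', \<psi>) \<in> poincare_triples emb" "support B \<inter> S = {}" for B \<psi>
  proof -
    have "(B, E + fun_div emb (inverse f), \<psi>) \<in> poincare_triples emb"
      using B(1) unfolding E'[symmetric] .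
    then have "(B, E, norm_map (inverse f) \<psi>) \<in> poincare_triples emb"
      using f(1) E by (intro norm_map_triple) simp_all
    \<comment> \<open>The hypothesis is applied to the factor transported by
      \<open>inverse f\<close>, which \<open>norm_map f\<close> takes back to
      \<open>\<psi>\<close>.\<close>
    from fS[OF this B(2)] show ?thesis
      using f(1) by (simp add: norm_map_norm_map equivclp_sym)
  qed
  then show ?thesis
    unfolding t translates.simps using f(1,3)
    by (intro exI[of _ "inverse f"] exI[of _ S] conjI E' allI impI) auto
qed

text \<open>For \<open>change_E\<close>, \<open>norm_map\<close> commutes with pointwise products
  and the exceptional set is empty. For \<open>change_D\<close> the second divisor stays, so the
  function is 1, and \<open>B\<close> must avoid the divisor of the section for
  \<open>change_D_mult\<close>.\<close>

lemma identification_translates: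
  assumes "identification emb t t'"
  shows "translates t t'"
  using assms
proof cases
  case (change_E f D E \<phi>)
  have "(D + B, E + fun_div emb f, \<lambda>\<sigma>. \<phi> \<sigma> * \<psi> \<sigma>) \<sim>\<^sub>P
      (D + B, E, \<lambda>\<sigma>. norm_map f \<phi> \<sigma> * norm_map f \<psi> \<sigma>)"
    if B: "(B, E + fun_div emb f, \<psi>) \<in> poincare_triples emb" for B \<psi>
  proof -
    have E: "E \<in> divisors0 emb" using change_E by (simp add: poincare_triples_def)
    have m: "norm_map f (\<lambda>\<sigma>. \<phi> \<sigma> * \<psi> \<sigma>) = (\<lambda>\<sigma>. norm_map f \<phi> \<sigma> * norm_map f \<psi> \<sigma>)"
      by (rule ext) (simp add: norm_map_def)
    have T: "(D + B, E + fun_div emb f, \<lambda>\<sigma>. \<phi> \<sigma> * \<psi> \<sigma>) \<in> poincare_triples emb"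
      using change_E B by (intro triples_mult) auto
    have "identification emb (D + B, E + fun_div emb f, \<lambda>\<sigma>. \<phi> \<sigma> * \<psi> \<sigma>)
        (D + B, E, norm_map f (\<lambda>\<sigma>. \<phi> \<sigma> * \<psi> \<sigma>))"
      using T E \<open>f \<noteq> 0\<close> by (intro identification.change_E norm_map_triple)
    then show ?thesis unfolding m by blast
  qed
  then show ?thesis using change_E unfolding change_E(1,2) translates.simps
    by (intro exI[of _ f] exI[of _ "{}"]) auto
next
  case (change_D f s c D E)
  show ?thesis unfolding change_D(1,2) translates.simps
  proof (intro exI[of _ 1] exI[of _ "support (section_div emb (O_bundle E) s)"] conjI allI impI)
    show "finite (support (section_div emb (O_bundle E) s))"
      using section_div_divisors change_D by (simp add: divisors_def)
    fix B \<psi>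
    assume B: "(B, E, \<psi>) \<in> poincare_triples emb"
      "support B \<inter> support (section_div emb (O_bundle E) s) = {}"
    show "(D + fun_div emb f + B, E, \<lambda>\<sigma>. c * section_norm emb (D + fun_div emb f) (O_bundle E) s \<sigma> * \<psi> \<sigma>)
      \<sim>\<^sub>P (D + B, E, \<lambda>\<sigma>. c * (eval_div emb f (section_div emb (O_bundle E) s) *
        section_norm emb D (O_bundle E) s \<sigma>) * norm_map 1 \<psi> \<sigma>)"
      unfolding norm_map_one
      using change_D B by (intro r_into_equivclp change_D_mult) (auto simp: disjoint_div_def)
  qed (auto simp: fun_div_one)
qed

lemma identified_translates:
  assumes "t \<sim>\<^sub>P t'" "t \<in> poincare_triples emb"
  shows "translates t t'"
  using assms
proof (induction)
  case base
  show ?case by (rule translates_refl)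
next
  case (step y z)
  have T: "y \<in> poincare_triples emb" "z \<in> poincare_triples emb"
    using step.hyps identification_triples by blast+
  \<comment> \<open>A link of \<open>equivclp\<close> may run in either direction; the backward one
    is covered by \<open>translates_sym\<close>.\<close>
  have "translates y z"
    using step.hyps(2) identification_translates translates_sym T by blast
  with step T show ?case using translates_trans by blast
qed

text \<open>A function \<open>h\<close> cancels \<open>A\<close> on \<open>S\<close>, and a section
  \<open>s\<close> is chosen whose divisor avoids \<open>A\<close>, the divisor of \<open>h\<close>
  and \<open>R\<close>. This one \<open>s\<close> serves the change from \<open>A\<close> to
  \<open>B\<close> and every product with a \<open>C\<close> supported in \<open>R\<close>.\<close>

lemma move:
  assumes A: "(A, E, \<phi>) \<in> poincare_triples emb" and fin: "finite S" "finite R"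
  obtains B \<chi> where "(B, E, \<chi>) \<in> poincare_triples emb" "support B \<inter> S = {}"
    "(A, E, \<phi>) \<sim>\<^sub>P (B, E, \<chi>)"
    "\<And>C \<psi>. (C, E, \<psi>) \<in> poincare_triples emb \<Longrightarrow> support C \<subseteq> R \<Longrightarrow>
      (A + C, E, \<lambda>\<sigma>. \<phi> \<sigma> * \<psi> \<sigma>) \<sim>\<^sub>P (B + C, E, \<lambda>\<sigma>. \<chi> \<sigma> * \<psi> \<sigma>)"
proof -
  have A': "A \<in> divisors0 emb" "A \<in> divisors emb" and E: "E \<in> divisors0 emb" "E \<in> divisors emb"
    using A by (auto simp: poincare_triples_def divisors0_def)
  obtain h where h: "h \<noteq> 0" "\<And>P. P \<in> S \<inter> points emb \<Longrightarrow> val_at P h = - A P"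
    using weak_approximation[of "S \<inter> points emb" "\<lambda>P. - A P"] fin by auto
  define B where "B = A + fun_div emb h"
  have B: "B \<in> divisors0 emb" "B \<in> divisors emb"
    using divisors0_add[OF A'(1) fun_div_divisors0[OF h(1)]] by (auto simp: B_def divisors0_def)
  have BS: "support B \<inter> S = {}"
    using h(2) divisors_outside[OF B(2)] by (auto simp: B_def support_def fun_div_def)
  define T where "T = (support A \<union> support (fun_div emb h) \<union> R) \<inter> points emb"
  have "finite T" using A' fin finite_fun_div[OF h(1)] by (auto simp: T_def divisors_def)
  \<comment> \<open>A function of value \<open>- E P\<close> at \<open>P\<close> generates the stalk
    of \<open>O_bundle E\<close> there, so the divisor of \<open>s\<close> as a section vanishes on
    \<open>T\<close>.\<close>
  then obtain s where s: "s \<noteq> 0" "\<And>P. P \<in> T \<Longrightarrow> val_at P s = - E P"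
    using weak_approximation[of T "\<lambda>P. - E P"] by (auto simp: T_def)
  let ?s = "section_div emb (O_bundle E) s"
  have disj: "disjoint_div ?s Z" if "support Z \<subseteq> support A \<union> support (fun_div emb h) \<union> R" for Z
  proof -
    have "?s P = 0" if "P \<in> support A \<union> support (fun_div emb h) \<union> R" for P
    proof (cases "P \<in> points emb")
      case True
      then show ?thesis using that s section_div_O_bundle[OF E(2) s(1)] by (simp add: T_def fun_div_def)
    next
      case False
      then show ?thesis by (simp add: section_div_def)
    qed
    with that show ?thesis by (auto simp: disjoint_div_def support_def)
  qed
  have e: "eval_div emb h ?s \<noteq> 0"
    using h s E disj by (intro eval_div_nonzero section_div_divisors) auto
  obtain d where d: "d \<noteq> 0" "\<phi> = (\<lambda>\<sigma>. d * section_norm emb A (O_bundle E) s \<sigma>)"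
    using triples_proportional[OF section_norm_triple[OF A'(1) E(1) s(1) disj] A] by auto
  \<comment> \<open>Normalised so that \<open>change_D\<close>, going from \<open>B\<close> to
    \<open>A\<close>, ends exactly in \<open>\<phi>\<close>.\<close>
  define c where "c = d / eval_div emb h ?s"
  have c: "c \<noteq> 0" using d e by (simp add: c_def)
  have \<phi>: "\<phi> = (\<lambda>\<sigma>. c * (eval_div emb h ?s * section_norm emb A (O_bundle E) s \<sigma>))"
    using d e by (simp add: c_def)
  define \<chi> where "\<chi> = (\<lambda>\<sigma>. c * section_norm emb B (O_bundle E) s \<sigma>)"
  have id: "identification emb (B, E, \<chi>) (A, E, \<phi>)"
    unfolding \<phi> \<chi>_def B_def using h s c A' E B disj
    by (intro change_D) (auto simp flip: B_def)
  have "(A + C, E, \<lambda>\<sigma>. \<phi> \<sigma> * \<psi> \<sigma>) \<sim>\<^sub>P (B + C, E, \<lambda>\<sigma>. \<chi> \<sigma> * \<psi> \<sigma>)"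
    if "(C, E, \<psi>) \<in> poincare_triples emb" "support C \<subseteq> R" for C \<psi>
    unfolding \<phi> \<chi>_def B_def using h s c A' E that disj disj[OF le_supI2[OF that(2)]]
    by (intro converse_r_into_equivclp change_D_mult) auto
  then show thesis using BS id identification_triples[OF id] by (intro that[of B \<chi>]) auto
qed

text \<open>A chain of five links: \<open>D'\<close> is replaced by \<open>B\<close>,
  \<open>D\<close> is carried to \<open>A\<close> over \<open>E'\<close>, \<open>A\<close> is
  replaced by \<open>C\<close>, \<open>B\<close> is carried to \<open>A'\<close>, and
  \<open>C\<close> is turned back into \<open>A\<close>. Here \<open>B\<close> avoids the
  exceptional set \<open>S\<close> of the first transport and \<open>C\<close> the set
  \<open>R\<close> of the second.\<close>

theorem left_mult_well_defined:
  assumes \<phi>: "(D, E, \<phi>) \<sim>\<^sub>P (A, E', \<phi>')" and \<psi>: "(D', E, \<psi>) \<sim>\<^sub>P (A', E', \<psi>')"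
    and T: "(D, E, \<phi>) \<in> poincare_triples emb" "(D', E, \<psi>) \<in> poincare_triples emb"
  shows "(D + D', E, \<lambda>\<sigma>. \<phi> \<sigma> * \<psi> \<sigma>) \<sim>\<^sub>P (A + A', E', \<lambda>\<sigma>. \<phi>' \<sigma> * \<psi>' \<sigma>)"
proof -
  have T': "(A, E', \<phi>') \<in> poincare_triples emb" "(A', E', \<psi>') \<in> poincare_triples emb"
    using identified_triples \<phi> \<psi> T by blast+
  have fin: "finite (support Z)" if "(Z, Y, \<omega>) \<in> poincare_triples emb" for Z Y \<omega>
    using that by (auto simp: poincare_triples_def divisors0_def divisors_def)
  have E': "E' \<in> divisors0 emb" using T' by (simp add: poincare_triples_def)
  obtain f S where f: "f \<noteq> 0" "E = E' + fun_div emb f" "finite S"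
    and fS: "\<And>B \<omega>. (B, E, \<omega>) \<in> poincare_triples emb \<Longrightarrow> support B \<inter> S = {} \<Longrightarrow>
       (D + B, E, \<lambda>\<sigma>. \<phi> \<sigma> * \<omega> \<sigma>) \<sim>\<^sub>P (A + B, E', \<lambda>\<sigma>. \<phi>' \<sigma> * norm_map f \<omega> \<sigma>)"
    using identified_translates[OF \<phi> T(1)] unfolding translates.simps by blast
  obtain B \<chi> where B: "(B, E, \<chi>) \<in> poincare_triples emb" "support B \<inter> S = {}"
      "(D', E, \<psi>) \<sim>\<^sub>P (B, E, \<chi>)"
    and BD: "(D' + D, E, \<lambda>\<sigma>. \<psi> \<sigma> * \<phi> \<sigma>) \<sim>\<^sub>P (B + D, E, \<lambda>\<sigma>. \<chi> \<sigma> * \<phi> \<sigma>)"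
    by (rule move[OF T(2) f(3) fin[OF T(1)]]) (use T(1) in blast)
  define \<chi>' where "\<chi>' = norm_map f \<chi>"
  have B': "(B, E', \<chi>') \<in> poincare_triples emb"
    unfolding \<chi>'_def using B f E' by (intro norm_map_triple) auto
  have "identification emb (B, E, \<chi>) (B, E', \<chi>')"
    unfolding \<chi>'_def f(2) using B B' f by (intro change_E) (auto simp: \<chi>'_def)
  then have "(B, E', \<chi>') \<sim>\<^sub>P (B, E, \<chi>)" by blast
  also have "(B, E, \<chi>) \<sim>\<^sub>P (D', E, \<psi>)" using B(3) by (rule equivclp_sym)
  also note \<psi>
  finally have "translates (B, E', \<chi>') (A', E', \<psi>')" using B' by (rule identified_translates)
  \<comment> \<open>Both triples lie over the same \<open>E'\<close>, so \<open>g\<close> has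
    divisor 0 and \<open>norm_map g\<close> will not change the other factor, by
    \<open>norm_map_trivial\<close>.\<close>
  then obtain g R where g: "g \<noteq> 0" "E' = E' + fun_div emb g" "finite R"
    and gR: "\<And>C \<omega>. (C, E', \<omega>) \<in> poincare_triples emb \<Longrightarrow> support C \<inter> R = {} \<Longrightarrow>
       (B + C, E', \<lambda>\<sigma>. \<chi>' \<sigma> * \<omega> \<sigma>) \<sim>\<^sub>P (A' + C, E', \<lambda>\<sigma>. \<psi>' \<sigma> * norm_map g \<omega> \<sigma>)"
    unfolding translates.simps by blast
  have g0: "fun_div emb g = 0" using g(2) by simp
  \<comment> \<open>\<open>C\<close> has to be interchangeable with \<open>A\<close> in products
    over \<open>B\<close> and over \<open>A'\<close>, hence the union of the two supports.\<close>
  obtain C \<omega> where C: "(C, E', \<omega>) \<in> poincare_triples emb" "support C \<inter> R = {}"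
    and CZ: "\<And>Z \<theta>. (Z, E', \<theta>) \<in> poincare_triples emb \<Longrightarrow> support Z \<subseteq> support B \<union> support A' \<Longrightarrow>
      (A + Z, E', \<lambda>\<sigma>. \<phi>' \<sigma> * \<theta> \<sigma>) \<sim>\<^sub>P (C + Z, E', \<lambda>\<sigma>. \<omega> \<sigma> * \<theta> \<sigma>)"
    by (rule move[OF T'(1) g(3), of "support B \<union> support A'"]) (use fin[OF B'] fin[OF T'(2)] in blast)+
  have "(D + D', E, \<lambda>\<sigma>. \<phi> \<sigma> * \<psi> \<sigma>) \<sim>\<^sub>P (D + B, E, \<lambda>\<sigma>. \<phi> \<sigma> * \<chi> \<sigma>)"
    using BD by (simp add: ac_simps)
  also have "(D + B, E, \<lambda>\<sigma>. \<phi> \<sigma> * \<chi> \<sigma>) \<sim>\<^sub>P (A + B, E', \<lambda>\<sigma>. \<phi>' \<sigma> * \<chi>' \<sigma>)"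
    unfolding \<chi>'_def using B by (intro fS)
  also have "(A + B, E', \<lambda>\<sigma>. \<phi>' \<sigma> * \<chi>' \<sigma>) \<sim>\<^sub>P (C + B, E', \<lambda>\<sigma>. \<omega> \<sigma> * \<chi>' \<sigma>)"
    using B' by (intro CZ) auto
  also have "(C + B, E', \<lambda>\<sigma>. \<omega> \<sigma> * \<chi>' \<sigma>) \<sim>\<^sub>P (C + A', E', \<lambda>\<sigma>. \<omega> \<sigma> * \<psi>' \<sigma>)"
    using gR[OF C] norm_map_trivial[OF g(1) g0 C(1)] by (simp add: ac_simps)
  also have "(C + A', E', \<lambda>\<sigma>. \<omega> \<sigma> * \<psi>' \<sigma>) \<sim>\<^sub>P (A + A', E', \<lambda>\<sigma>. \<phi>' \<sigma> * \<psi>' \<sigma>)"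
    using T' by (intro equivclp_sym[OF CZ]) auto
  finally show ?thesis .
qed

lemma poincare_point_eqI: "t \<sim>\<^sub>P t' \<Longrightarrow> poincare_point emb t = poincare_point emb t'"
  unfolding poincare_point_def by (blast intro: equivclp_trans equivclp_sym)

text \<open>Independence of representatives supplies the uniqueness behind the definite description
  in \<open>left_mult\<close>, so the law can be computed on any given representatives over the same
  \<open>E\<close>.\<close>

lemma left_mult_point:
  assumes T: "(D, E, \<phi>) \<in> poincare_triples emb" "(D', E, \<psi>) \<in> poincare_triples emb"
  shows "left_mult emb (poincare_point emb (D, E, \<phi>)) (poincare_point emb (D', E, \<psi>)) =
    poincare_point emb (D + D', E, \<lambda>\<sigma>. \<phi> \<sigma> * \<psi> \<sigma>)"
  unfolding left_mult_def
proof (rule the_equality)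
  show "\<exists>A A' E' \<phi>' \<psi>'. (A, E', \<phi>') \<in> poincare_point emb (D, E, \<phi>) \<and>
      (A', E', \<psi>') \<in> poincare_point emb (D', E, \<psi>) \<and>
      poincare_point emb (D + D', E, \<lambda>\<sigma>. \<phi> \<sigma> * \<psi> \<sigma>) =
      poincare_point emb (A + A', E', \<lambda>\<sigma>. \<phi>' \<sigma> * \<psi>' \<sigma>)"
    unfolding poincare_point_def
    by (rule exI[of _ D], rule exI[of _ D'], rule exI[of _ E], rule exI[of _ \<phi>], rule exI[of _ \<psi>]) simp
next
  fix r
  assume "\<exists>A A' E' \<phi>' \<psi>'. (A, E', \<phi>') \<in> poincare_point emb (D, E, \<phi>) \<and>
      (A', E', \<psi>') \<in> poincare_point emb (D', E, \<psi>) \<and>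
      r = poincare_point emb (A + A', E', \<lambda>\<sigma>. \<phi>' \<sigma> * \<psi>' \<sigma>)"
  then obtain A A' E' \<phi>' \<psi>' where "(D, E, \<phi>) \<sim>\<^sub>P (A, E', \<phi>')" "(D', E, \<psi>) \<sim>\<^sub>P (A', E', \<psi>')"
      and r: "r = poincare_point emb (A + A', E', \<lambda>\<sigma>. \<phi>' \<sigma> * \<psi>' \<sigma>)"
    unfolding poincare_point_def by blast
  from left_mult_well_defined[OF this(1,2) T] show "r = poincare_point emb (D + D', E, \<lambda>\<sigma>. \<phi> \<sigma> * \<psi> \<sigma>)"
    unfolding r by (rule poincare_point_eqI[OF equivclp_sym])
qed

section \<open>The scalar action on the torsor\<close>

definition scale_triple ::
    "'k \<Rightarrow> ('f set \<Rightarrow> int) \<times> ('f set \<Rightarrow> int) \<times> (('f set \<Rightarrow> 'f) \<Rightarrow> 'k) \<Rightarrow>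
     ('f set \<Rightarrow> int) \<times> ('f set \<Rightarrow> int) \<times> (('f set \<Rightarrow> 'f) \<Rightarrow> 'k)" where
  "scale_triple c = (\<lambda>(D, E, \<phi>). (D, E, \<lambda>\<sigma>. c * \<phi> \<sigma>))"

lemma scale_triple_inverse [simp]: "c \<noteq> 0 \<Longrightarrow> scale_triple c (scale_triple (inverse c) t) = t"
  by (cases t) (simp add: scale_triple_def mult.assoc[symmetric])

text \<open>\<open>norm_map\<close> commutes with scalars, and in \<open>change_D\<close> the factor
  is absorbed into the free constant.\<close>

lemma identification_scale:
  assumes "c \<noteq> 0" "identification emb t t'"
  shows "identification emb (scale_triple c t) (scale_triple c t')"
  using assms(2)
proof cases
  case (change_E f D E \<phi>)
  have m: "(\<lambda>\<sigma>. c * norm_map f \<phi> \<sigma>) = norm_map f (\<lambda>\<sigma>. c * \<phi> \<sigma>)"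
    by (rule ext) (simp add: norm_map_def)
  have "(D, E + fun_div emb f, \<lambda>\<sigma>. c * \<phi> \<sigma>) \<in> poincare_triples emb"
      "(D, E, \<lambda>\<sigma>. c * norm_map f \<phi> \<sigma>) \<in> poincare_triples emb"
    using change_E assms(1) by (auto intro: triples_scale)
  then show ?thesis
    unfolding change_E(1,2) scale_triple_def using change_E(3)
    by (auto simp: m intro: identification.change_E)
next
  case (change_D f s d D E)
  then show ?thesis
    using identification.change_D[of f s "c * d" D emb E] assms(1)
    by (simp add: scale_triple_def mult.assoc)
qed

lemma identified_scale:
  assumes "c \<noteq> 0" "t \<sim>\<^sub>P t'"
  shows "scale_triple c t \<sim>\<^sub>P scale_triple c t'"
  using assms(2)
proof (induction)
  case (step y z)
  then show ?case using identification_scale[OF assms(1)] equivclp_into_equivclp by metis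
qed simp

text \<open>Scaling respects classes, and scaling back by the inverse shows that the image of a
  class is a whole class rather than a part of one.\<close>

lemma poincare_scale_point:
  assumes "c \<noteq> 0"
  shows "poincare_scale c (poincare_point emb t) = poincare_point emb (scale_triple c t)"
proof -
  have "u \<in> scale_triple c ` {t'. t \<sim>\<^sub>P t'}" if "scale_triple c t \<sim>\<^sub>P u" for u
  proof -
    have "scale_triple (inverse c) (scale_triple c t) \<sim>\<^sub>P scale_triple (inverse c) u"
      using assms that by (intro identified_scale) auto
    then have "t \<sim>\<^sub>P scale_triple (inverse c) u"
      using assms scale_triple_inverse[of "inverse c" t] by simp
    then show ?thesis using assms by (intro image_eqI[of _ _ "scale_triple (inverse c) u"]) auto
  qed
  then have "scale_triple c ` {t'. t \<sim>\<^sub>P t'} = {t'. scale_triple c t \<sim>\<^sub>P t'}"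
    using identified_scale[OF assms] by blast
  then show ?thesis by (simp add: poincare_scale_def poincare_point_def scale_triple_def)
qed

end

section \<open>Line bundles and the theorem\<close>

context function_field
begin

section \<open>Generators of tensor products, powers and duals\<close>

context
  fixes P :: "'f set"
  assumes P: "P \<in> points emb"
begin

lemma local_gen_structure_sheaf: "local_gen (\<lambda>P. P) P 1"
  by (simp add: local_gen_def)

lemma local_gen_tensor:
  assumes "local_gen M P g" "local_gen N P h"
  shows "local_gen (bundle_tensor M N) P (g * h)"
proof -
  have "bundle_tensor M N P = (\<lambda>a. g * h * a) ` P"
  proof (intro equalityI subsetI)
    fix x assume "x \<in> bundle_tensor M N P"
    then obtain a b where "a \<in> P" "b \<in> P" "x = (g * a) * (h * b)"
      using assms by (auto simp: bundle_tensor_def local_gen_def)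
    then show "x \<in> (\<lambda>a. g * h * a) ` P"
      using mult_mem[OF P] by (intro image_eqI[of _ _ "a * b"]) (auto simp: mult_ac)
  next
    fix x assume "x \<in> (\<lambda>a. g * h * a) ` P"
    then obtain a where a: "a \<in> P" "x = (g * a) * (h * 1)" by (auto simp: mult_ac)
    have "g * a \<in> M P" "h * 1 \<in> N P"
      using assms a one_mem[OF P] unfolding local_gen_def by blast+
    with a(2) show "x \<in> bundle_tensor M N P" unfolding bundle_tensor_def by blast
  qed
  then show ?thesis using assms by (simp add: local_gen_def)
qed

lemma local_gen_pow: "local_gen M P g \<Longrightarrow> local_gen (bundle_pow M n) P (g ^ n)"
proof (induction n)
  case 0
  then show ?case by (simp add: local_gen_structure_sheaf)
next
  case (Suc n)
  then show ?case using local_gen_tensor[of "bundle_pow M n" "g ^ n" M g] by (simp add: mult.commute)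
qed

text \<open>Membership in the dual stalk can be tested on the generator alone: \<open>a\<close>
  belongs to it when \<open>a * g\<close> lies in \<open>P\<close>.\<close>

lemma local_gen_dual:
  assumes "local_gen M P g"
  shows "local_gen (bundle_dual M) P (inverse g)"
proof -
  have g: "g \<noteq> 0" "M P = (\<lambda>a. g * a) ` P" using assms by (auto simp: local_gen_def)
  have "a \<in> bundle_dual M P \<longleftrightarrow> a * g \<in> P" for a
  proof
    assume "a \<in> bundle_dual M P"
    moreover have "g * 1 \<in> M P" unfolding g(2) using one_mem[OF P] by blast
    ultimately show "a * g \<in> P" by (auto simp: bundle_dual_def)
  next
    assume "a * g \<in> P"
    then have "a * (g * b) \<in> P" if "b \<in> P" for b
      using mult_mem[OF P \<open>a * g \<in> P\<close> that] by (simp add: mult.assoc)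
    then show "a \<in> bundle_dual M P" by (auto simp: bundle_dual_def g(2))
  qed
  moreover have "a * g \<in> P \<longleftrightarrow> a \<in> (\<lambda>b. inverse g * b) ` P" for a
    using g(1) by (auto simp: image_iff field_simps intro: bexI[of _ "a * g"])
  ultimately show ?thesis using g(1) by (auto simp: local_gen_def)
qed

end

lemma section_div_shift:
  assumes L: "line_bundle emb L" and s: "s \<noteq> 0"
  shows "section_div emb L s = fun_div emb s + section_div emb L 1"
proof
  fix P
  show "section_div emb L s P = (fun_div emb s + section_div emb L 1) P"
  proof (cases "P \<in> points emb")
    case P: True
    then obtain g where g: "local_gen L P g" using L by (auto simp: line_bundle_def)
    show ?thesis
      using section_div_local_gen[OF P g s] section_div_local_gen[OF P g, of 1] P
      by (simp add: fun_div_def val_one)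
  qed (simp add: section_div_def fun_div_def)
qed

text \<open>Since \<open>g ^ n\<close> generates the power when \<open>g\<close> generates
  \<open>L\<close>, the divisor of the section 1 of \<open>L\<close> serves as a reference, of which
  the \<open>n\<close>-th power contributes \<open>n\<close> copies.\<close>

lemma section_div_pow:
  assumes L: "line_bundle emb L" and "s \<noteq> 0"
  shows "section_div emb (bundle_pow L n) s = (\<lambda>P. fun_div emb s P + int n * section_div emb L 1 P)"
proof
  fix P
  show "section_div emb (bundle_pow L n) s P = fun_div emb s P + int n * section_div emb L 1 P"
  proof (cases "P \<in> points emb")
    case P: True
    then obtain g where g: "local_gen L P g" using L by (auto simp: line_bundle_def)
    then have "g \<noteq> 0" by (simp add: local_gen_def)
    then show ?thesis
      using section_div_local_gen[OF P local_gen_pow[OF P g] assms(2)]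
        section_div_local_gen[OF P g, of 1] P
      by (simp add: fun_div_def val_power val_one)
  qed (simp add: section_div_def fun_div_def)
qed

lemma section_div_dual_tensor:
  assumes L: "line_bundle emb L" and s: "s \<noteq> 0" and D: "D \<in> divisors emb"
  shows "section_div emb (bundle_tensor (bundle_dual L) (O_bundle D)) s =
    fun_div emb s + D - section_div emb L 1"
proof
  fix P
  show "section_div emb (bundle_tensor (bundle_dual L) (O_bundle D)) s P =
    (fun_div emb s + D - section_div emb L 1) P"
  proof (cases "P \<in> points emb")
    case P: True
    then obtain g where g: "local_gen L P g" using L by (auto simp: line_bundle_def)
    obtain t where t: "t \<noteq> 0" "val_at P t = - D P" using ex_val_eq[OF P] .
    then have "local_gen (O_bundle D) P t" using P by (simp add: local_gen_O_bundle_iff)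
    note gen = local_gen_tensor[OF P local_gen_dual[OF P g] this]
    have "g \<noteq> 0" using g by (simp add: local_gen_def)
    then show ?thesis
      using section_div_local_gen[OF P gen s] section_div_local_gen[OF P g, of 1] P t
      by (simp add: fun_div_def val_mult val_inverse val_one)
  next
    case False
    then show ?thesis using divisors_outside[OF D] by (simp add: section_div_def fun_div_def)
  qed
qed

section \<open>Divisor classes as cosets of the principal divisors\<close>

definition principal_coset :: "('f set \<Rightarrow> int) \<Rightarrow> ('f set \<Rightarrow> int) set" where
  "principal_coset A = {fun_div emb f + A |f. f \<noteq> 0}"

lemma principal_coset_eq:
  assumes f: "f \<noteq> 0"
  shows "principal_coset (fun_div emb f + A) = principal_coset A"
proof (intro equalityI subsetI)
  fix B assume "B \<in> principal_coset (fun_div emb f + A)"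
  then obtain h where h: "h \<noteq> 0" "B = fun_div emb h + (fun_div emb f + A)"
    by (auto simp: principal_coset_def)
  then have "B = fun_div emb (h * f) + A" "h * f \<noteq> 0" using f by (auto simp: fun_div_mult)
  then show "B \<in> principal_coset A" unfolding principal_coset_def by blast
next
  fix B assume "B \<in> principal_coset A"
  then obtain h where h: "h \<noteq> 0" "B = fun_div emb h + A"
    by (auto simp: principal_coset_def)
  then have "B = fun_div emb (h / f) + (fun_div emb f + A)" "h / f \<noteq> 0" using f by (auto simp: fun_div_divide)
  then show "B \<in> principal_coset (fun_div emb f + A)" unfolding principal_coset_def by blast
qed

lemma principal_coset_self: "A \<in> principal_coset A"
  unfolding principal_coset_def using fun_div_one by force

lemma principal_coset_carrier: "A \<in> divisors0 emb \<Longrightarrow> principal_coset A \<in> carrier (jacobian emb)"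
  by (auto simp: jacobian_def FactGroup_def RCOSETS_def r_coset_def principal_coset_def)

lemma principal_coset_mult:
  "principal_coset A \<otimes>\<^bsub>jacobian emb\<^esub> principal_coset B = principal_coset (A + B)"
proof -
  have "principal_coset A \<otimes>\<^bsub>jacobian emb\<^esub> principal_coset B =
      {C + C' |C C'. C \<in> principal_coset A \<and> C' \<in> principal_coset B}"
    by (auto simp: jacobian_def FactGroup_def set_mult_def)
  also have "\<dots> = principal_coset (A + B)"
  proof (intro equalityI subsetI)
    fix Z assume "Z \<in> {C + C' |C C'. C \<in> principal_coset A \<and> C' \<in> principal_coset B}"
    then obtain f h where "f \<noteq> 0" "h \<noteq> 0" "Z = (fun_div emb f + A) + (fun_div emb h + B)"
      by (auto simp: principal_coset_def)
    then have "Z = fun_div emb (f * h) + (A + B)" "f * h \<noteq> 0" by (auto simp: fun_div_mult ac_simps)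
    then show "Z \<in> principal_coset (A + B)" unfolding principal_coset_def by blast
  next
    fix Z assume "Z \<in> principal_coset (A + B)"
    then obtain f where "f \<noteq> 0" "Z = (fun_div emb f + A) + B"
      by (auto simp: principal_coset_def ac_simps)
    then show "Z \<in> {C + C' |C C'. C \<in> principal_coset A \<and> C' \<in> principal_coset B}"
      using principal_coset_self[of B] unfolding principal_coset_def by blast
  qed
  finally show ?thesis .
qed

lemma bundle_class_dual_tensor:
  assumes L: "line_bundle emb L" and D: "D \<in> divisors emb"
  shows "bundle_class emb (bundle_tensor (bundle_dual L) (O_bundle D)) =
    principal_coset (D - section_div emb L 1)"
  unfolding bundle_class_def principal_coset_def
  using section_div_dual_tensor[OF L _ D] by (metis (no_types, opaque_lifting) add_diff_eq)

text \<open>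
  A line bundle of nonzero degree makes principal divisors finite of degree 0, because
  \<open>div_degree\<close> takes the value 0 on divisors of infinite support.
\<close>

lemma complete_curve_of_degree:
  assumes L: "line_bundle emb L" "has_bundle_degree emb L d" "d \<noteq> 0"
    and rat: "\<exists>P. rational_point emb P"
  shows "complete_curve emb"
proof -
  have deg: "div_degree emb (section_div emb L s) = d" if "s \<noteq> 0" for s
    using L(2) that by (simp add: has_bundle_degree_def)
  have fin: "finite (support (section_div emb L s))" if "s \<noteq> 0" for s
  proof (rule ccontr)
    assume "infinite (support (section_div emb L s))"
    then have "div_degree emb (section_div emb L s) = 0" by (simp add: div_degree_def)
    then show False using deg[OF that] L(3) by simp
  qed
  have eq: "fun_div emb f = section_div emb L f - section_div emb L 1" if "f \<noteq> 0" for f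
    using section_div_shift[OF L(1) that] by simp
  show ?thesis
  proof
    show "finite (support (fun_div emb f))" if "f \<noteq> 0" for f
      using fin[OF that] fin[of 1] support_diff[of "section_div emb L f" "section_div emb L 1"]
      unfolding eq[OF that] by (auto intro: finite_subset)
    show "div_degree emb (fun_div emb f) = 0" if "f \<noteq> 0" for f
      unfolding eq[OF that] using fin[OF that] fin[of 1] deg[OF that] deg[of 1]
      by (simp add: div_degree_diff)
  qed (rule rat)
qed

end

section \<open>Norms of the section 1, and the theorem\<close>

context complete_curve
begin

text \<open>As a section of \<open>O_bundle E\<close>, the function 1 has divisor \<open>E\<close>,
  so disjointness of \<open>E\<close> and \<open>A\<close> is the condition for its norm along
  \<open>A\<close> to be a nonzero vector.\<close>

lemma div_pair_fibre:
  assumes A: "A \<in> divisors0 emb" and E: "E \<in> divisors0 emb" and disj: "disjoint_div E A"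
  shows "(A, E, section_norm emb A (O_bundle E) 1) \<in> poincare_triples emb"
    and "div_pair emb A E \<in> poincare_fibre emb (principal_coset A) (principal_coset E)"
proof -
  have "E \<in> divisors emb" using E by (simp add: divisors0_def)
  then have "section_div emb (O_bundle E) 1 = E"
    by (simp add: section_div_O_bundle fun_div_one)
  then show T: "(A, E, section_norm emb A (O_bundle E) 1) \<in> poincare_triples emb"
    using A E disj by (intro section_norm_triple) auto
  show "div_pair emb A E \<in> poincare_fibre emb (principal_coset A) (principal_coset E)"
    unfolding div_pair_def poincare_fibre_def using T principal_coset_self by blast
qed

text \<open>The product is the norm of the section 1 along \<open>A + A'\<close>, that is, along
  \<open>B + fun_div emb f\<close>. This section has divisor \<open>E\<close>, so
  \<open>change_D\<close> yields the factor \<open>eval_div emb f E\<close>.\<close>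

theorem left_mult_div_pair:
  assumes A: "A \<in> divisors0 emb" "A' \<in> divisors0 emb" "B \<in> divisors0 emb" and E: "E \<in> divisors0 emb"
    and disj: "disjoint_div E A" "disjoint_div E A'" "disjoint_div E B"
    and f: "f \<noteq> 0" "A + A' = B + fun_div emb f"
  shows "left_mult emb (div_pair emb A E) (div_pair emb A' E) =
    poincare_scale (eval_div emb f E) (div_pair emb B E)"
proof -
  have E': "E \<in> divisors emb" using E by (simp add: divisors0_def)
  have div: "A \<in> divisors emb" "A' \<in> divisors emb" using A by (auto simp: divisors0_def)
  have one: "section_div emb (O_bundle E) 1 = E"
    using E' by (simp add: section_div_O_bundle fun_div_one)
  \<comment> \<open>The divisor of \<open>f\<close> avoids \<open>E\<close> because it is composed
    of \<open>A\<close>, \<open>A'\<close> and \<open>B\<close>, which all do.\<close>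
  have "fun_div emb f = A + A' - B" using f(2) by simp
  moreover have "A P = 0 \<and> A' P = 0 \<and> B P = 0" if "E P \<noteq> 0" for P
    using disj that by (auto simp: disjoint_div_def support_def)
  ultimately have disj_f: "disjoint_div E (fun_div emb f)"
    by (auto simp: disjoint_div_def support_def)
  have "identification emb
      (B + fun_div emb f, E, \<lambda>\<sigma>. 1 * section_norm emb (B + fun_div emb f) (O_bundle E) 1 \<sigma>)
      (B, E, \<lambda>\<sigma>. 1 * (eval_div emb f (section_div emb (O_bundle E) 1) * section_norm emb B (O_bundle E) 1 \<sigma>))"
    using A E f disj disj_f by (intro change_D) (auto simp: one divisors0_add fun_div_divisors0)
  then have id: "poincare_point emb (A + A', E, section_norm emb (A + A') (O_bundle E) 1) =
      poincare_point emb (scale_triple (eval_div emb f E) (B, E, section_norm emb B (O_bundle E) 1))"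
    by (intro poincare_point_eqI r_into_equivclp) (simp add: one f(2) scale_triple_def)
  have "left_mult emb (div_pair emb A E) (div_pair emb A' E) =
      poincare_point emb (A + A', E, section_norm emb (A + A') (O_bundle E) 1)"
    unfolding div_pair_def
    using left_mult_point[OF div_pair_fibre(1)[OF A(1) E disj(1)] div_pair_fibre(1)[OF A(2) E disj(2)]]
      section_norm_add[OF div E', of 1] disj
    by (simp add: one)
  also have "\<dots> = poincare_scale (eval_div emb f E) (div_pair emb B E)"
    unfolding id div_pair_def
    by (rule poincare_scale_point[symmetric]) (rule eval_div_nonzero[OF f(1) E' disj_f])
  finally show ?thesis .
qed

text \<open>For the divisor \<open>E - E0\<close> this gives the shape of the factor
  \<open>l\<close>. The negative multiplicities turn into values of \<open>inverse f\<close>,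
  because local norms are multiplicative on units.\<close>

lemma eval_div_diff:
  assumes f: "f \<noteq> 0" and div: "A \<in> divisors emb" "B \<in> divisors emb"
    and disj: "disjoint_div A (fun_div emb f)" "disjoint_div B (fun_div emb f)"
  shows "eval_div emb f (A - B) = eval_div emb f A * eval_div emb (inverse f) B"
proof -
  have unit: "P \<in> points emb \<and> f \<in> local_units P" if "P \<in> support A \<union> support B" for P
  proof -
    have P: "P \<in> points emb" "fun_div emb f P = 0"
      using that div disj by (auto simp: divisors_def disjoint_div_def support_def)
    then show ?thesis using fun_div_zero_iff_unit[OF f] by blast
  qed
  let ?N = "\<lambda>P. norm_at emb P f"
  have "div_prod ?N (A + - B) = div_prod ?N A * div_prod ?N (- B)"
    using div unit norm_unit_nonzero by (intro div_prod_add) (auto simp: divisors_def)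
  moreover have "div_prod (\<lambda>P. norm_at emb P (inverse f)) B = div_prod ?N (- B)"
  proof -
    have "norm_at emb P (inverse f) = inverse (?N P)" if "P \<in> support B" for P
      using unit[of P] that norm_divide[of P 1 f] by (simp add: units_one divide_inverse norm_one)
    then have "div_prod (\<lambda>P. norm_at emb P (inverse f)) B = div_prod (\<lambda>P. inverse (?N P)) B"
      by (rule div_prod_cong)
    then show ?thesis
      unfolding div_prod_def by (simp add: power_int_inverse power_int_minus)
  qed
  ultimately show ?thesis by (simp add: eval_div_eq)
qed

end

theorem mainTheorem8:
  fixes emb :: "'k::field \<Rightarrow> 'f::field"
    and L :: "'f set \<Rightarrow> 'f set"
    and D0 D1 D2 D3 D4 E0 E :: "'f set \<Rightarrow> int"
    and d0 e0 s t :: 'f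
    and g :: nat and \<delta> :: int
    and x :: "('f set \<Rightarrow> int) \<Rightarrow> ('f set \<Rightarrow> int) set"
    and pt :: "('f set \<Rightarrow> int) \<Rightarrow> ('f set \<Rightarrow> int) \<Rightarrow>
      (('f set \<Rightarrow> int) \<times> ('f set \<Rightarrow> int) \<times> (('f set \<Rightarrow> 'f) \<Rightarrow> 'k)) set"
    and l :: 'k
  assumes curve: "is_curve emb" "genus emb = g" "\<exists>P. rational_point emb P"
    and L: "line_bundle emb L" "has_bundle_degree emb L \<delta>" "\<delta> \<ge> 2 * int g + 1"
    and d0: "d0 \<in> global_sections emb (bundle_pow L 1)" "d0 \<noteq> 0"
            "D0 = section_div emb (bundle_pow L 1) d0"
    and e0: "e0 \<in> global_sections emb (bundle_pow L 1)" "e0 \<noteq> 0"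
            "E0 = section_div emb (bundle_pow L 1) e0"
    and effective: "\<forall>D \<in> {D1, D2, D3, D4, E}. effective_of_degree emb \<delta> D"
    and disjoint: "\<forall>D \<in> {D0, D1, D2, D3, D4}. disjoint_div D E0 \<and> disjoint_div D E"
    and s: "s \<in> global_sections emb (bundle_pow L 3)" "s \<noteq> 0"
           "section_div emb (bundle_pow L 3) s = D1 + D2 + D3"
    and t: "t \<in> global_sections emb (bundle_pow L 2)" "t \<noteq> 0"
           "section_div emb (bundle_pow L 2) t = D3 + D4"
  defines "x \<equiv> \<lambda>D. bundle_class emb (bundle_tensor (bundle_dual L) (O_bundle D))"
    and "pt \<equiv> \<lambda>D E. div_pair emb (D - D0) (E - E0)"
    and "l \<equiv> eval_div emb (s / (t * d0)) E * eval_div emb ((t * d0) / s) E0"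
  shows "(\<forall>D \<in> {D1, D2, D3, D4}. x D \<in> carrier (jacobian emb))
       \<and> x D4 = x D1 \<otimes>\<^bsub>jacobian emb\<^esub> x D2
       \<and> (\<forall>D \<in> {D1, D2, D4}. pt D E \<in> poincare_fibre emb (x D) (x E))
       \<and> l \<noteq> 0
       \<and> left_mult emb (pt D1 E) (pt D2 E) = poincare_scale l (pt D4 E)"
proof -
  interpret function_field emb
    using curve(1) by (simp add: is_curve_def function_field_def)
  interpret complete_curve emb
    using complete_curve_of_degree[OF L(1,2) _ curve(3)] L(3) by simp
  \<comment> \<open>The reference divisor: as a section of the \<open>n\<close>-th power of
    \<open>L\<close>, a function has its own divisor plus \<open>n\<close> times
    \<open>\<kappa>\<close>.\<close>
  define \<kappa> where "\<kappa> = section_div emb L 1"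
  have D0: "D0 = fun_div emb d0 + \<kappa>" and E0: "E0 = fun_div emb e0 + \<kappa>"
    using section_div_pow[OF L(1), of _ 1] d0 e0 by (auto simp: \<kappa>_def fun_eq_iff)
  have "D0 = section_div emb L d0" "E0 = section_div emb L e0"
    unfolding D0 E0 \<kappa>_def
    by (rule section_div_shift[OF L(1) d0(2), symmetric] section_div_shift[OF L(1) e0(2), symmetric])+
  then have "div_degree emb D0 = \<delta>" "div_degree emb E0 = \<delta>"
    using d0(2) e0(2) L(2) by (auto simp: has_bundle_degree_def)
  moreover have "finite (support A)" "support A \<subseteq> points emb" if "A \<in> {D0, E0}" for A
  proof -
    show "finite (support A)"
    proof (rule ccontr)
      assume "infinite (support A)"
      \<comment> \<open>A sum over an infinite support is 0 by convention, whereas the degree is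
        \<open>\<delta>\<close>, which is at least 1.\<close>
      then have "div_degree emb A = 0" by (simp add: div_degree_def)
      then show False using that calculation L(3) by auto
    qed
    show "support A \<subseteq> points emb"
      using that d0 e0 by (auto simp: support_def section_div_def split: if_splits)
  qed
  ultimately have eff: "A \<in> divisors emb \<and> div_degree emb A = \<delta>" if "A \<in> {D0, E0, D1, D2, D3, D4, E}" for A
    using that effective by (auto simp: effective_of_degree_def divisors_def)
  have deg0: "A - B \<in> divisors0 emb" if "A \<in> {D0, E0, D1, D2, D3, D4, E}" "B \<in> {D0, E0}" for A B
  proof -
    have "A \<in> divisors emb" "B \<in> divisors emb" "div_degree emb A = \<delta>" "div_degree emb B = \<delta>"
      using eff[OF that(1)] eff[of B] that(2) by auto
    moreover from this have "finite (support A)" "finite (support B)" by (auto simp: divisors_def)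
    ultimately show ?thesis by (simp add: divisors0_def divisors_diff div_degree_diff)
  qed
  have disj: "disjoint_div (E - E0) (A - D0)" if "A \<in> {D0, D1, D2, D3, D4}" for A
  proof -
    have "disjoint_div A E0" "disjoint_div A E" "disjoint_div D0 E0" "disjoint_div D0 E"
      using that disjoint by auto
    then show ?thesis using support_diff[of E E0] support_diff[of A D0]
      unfolding disjoint_div_def by blast
  qed
  have x: "x A = principal_coset (A - D0)" if "A \<in> {D0, E0, D1, D2, D3, D4, E}" for A
  proof -
    have "x A = principal_coset (A - \<kappa>)"
      using bundle_class_dual_tensor[OF L(1)] eff[OF that] by (simp add: x_def \<kappa>_def)
    \<comment> \<open>The section \<open>d0\<close> links \<open>\<kappa>\<close> with
      \<open>D0\<close> and puts the class into the form that \<open>pt\<close> uses.\<close>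
    also have "A - \<kappa> = fun_div emb d0 + (A - D0)" by (simp add: D0)
    also have "principal_coset \<dots> = principal_coset (A - D0)" by (rule principal_coset_eq[OF d0(2)])
    finally show ?thesis .
  qed
  have xE: "x E = principal_coset (E - E0)"
  proof -
    \<comment> \<open>The second coordinate of \<open>pt\<close> is formed with \<open>E0\<close>
      instead of \<open>D0\<close>; the two differ by the divisor of \<open>e0 / d0\<close>.\<close>
    have "E - D0 = fun_div emb (e0 / d0) + (E - E0)"
      using d0(2) e0(2) by (simp add: D0 E0 fun_div_divide)
    moreover have "principal_coset (fun_div emb (e0 / d0) + (E - E0)) = principal_coset (E - E0)"
      using d0(2) e0(2) by (intro principal_coset_eq) simp
    ultimately show ?thesis using x[of E] by (simp only: insert_iff simp_thms)
  qed
  define f where "f = s / (t * d0)"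
  have f: "f \<noteq> 0" "inverse f = t * d0 / s" using s t d0 by (auto simp: f_def)
  have div_f: "fun_div emb f = D1 + D2 - D4 - D0"
  proof
    fix P
    \<comment> \<open>In the divisor of \<open>s / (t * d0)\<close> the multiples 3, 2 and 1 of
      \<open>\<kappa>\<close> cancel, and so does \<open>D3\<close>.\<close>
    have "fun_div emb s P + 3 * \<kappa> P = D1 P + D2 P + D3 P"
      using fun_cong[OF s(3), of P] section_div_pow[OF L(1) s(2), of 3] by (simp add: \<kappa>_def)
    moreover have "fun_div emb t P + 2 * \<kappa> P = D3 P + D4 P"
      using fun_cong[OF t(3), of P] section_div_pow[OF L(1) t(2), of 2] by (simp add: \<kappa>_def)
    moreover have "fun_div emb f P = fun_div emb s P - fun_div emb t P - fun_div emb d0 P"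
      using s t d0 by (simp add: f_def fun_div_divide fun_div_mult)
    ultimately show "fun_div emb f P = (D1 + D2 - D4 - D0) P" by (simp add: D0)
  qed
  \<comment> \<open>This is the relation required by \<open>left_mult_div_pair\<close>, with
    \<open>D4 - D0\<close> in the place of \<open>B\<close>.\<close>
  then have sum: "(D1 - D0) + (D2 - D0) = (D4 - D0) + fun_div emb f" by (simp add: algebra_simps)
  have disj_f: "disjoint_div A (fun_div emb f)" if "A \<in> {E, E0}" for A
  proof -
    have "D0 P = 0 \<and> D1 P = 0 \<and> D2 P = 0 \<and> D4 P = 0" if "A P \<noteq> 0" for P
      using that disjoint \<open>A \<in> {E, E0}\<close> by (auto simp: disjoint_div_def support_def)
    then show ?thesis by (auto simp: disjoint_div_def support_def div_f)
  qed
  have l: "l = eval_div emb f (E - E0)"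
    using eval_div_diff[OF f(1) _ _ disj_f disj_f] eff by (simp add: l_def f(2) f_def[symmetric])
  have "disjoint_div (E - E0) (fun_div emb f)"
    using disj_f support_diff[of E E0] by (auto simp: disjoint_div_def)
  then have "l \<noteq> 0"
    unfolding l using f deg0[of E E0] by (intro eval_div_nonzero) (auto simp: divisors0_def)
  moreover have "\<forall>D \<in> {D1, D2, D3, D4}. x D \<in> carrier (jacobian emb)"
    using x deg0 principal_coset_carrier by auto
  moreover have "x D4 = x D1 \<otimes>\<^bsub>jacobian emb\<^esub> x D2"
  proof -
    have "x D1 \<otimes>\<^bsub>jacobian emb\<^esub> x D2 = principal_coset ((D1 - D0) + (D2 - D0))"
      by (simp only: x insert_iff simp_thms principal_coset_mult)
    also have "(D1 - D0) + (D2 - D0) = fun_div emb f + (D4 - D0)"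
      unfolding sum by (rule add.commute)
    also have "principal_coset \<dots> = x D4"
      by (simp only: x insert_iff simp_thms principal_coset_eq[OF f(1)])
    finally show ?thesis by (rule sym)
  qed
  moreover have "\<forall>D \<in> {D1, D2, D4}. pt D E \<in> poincare_fibre emb (x D) (x E)"
  proof
    fix D assume "D \<in> {D1, D2, D4}"
    then show "pt D E \<in> poincare_fibre emb (x D) (x E)"
      unfolding pt_def xE using x[of D] deg0[of D D0] deg0[of E E0] disj[of D]
        div_pair_fibre(2)[of "D - D0" "E - E0"] by auto
  qed
  moreover have "left_mult emb (pt D1 E) (pt D2 E) = poincare_scale l (pt D4 E)"
    unfolding pt_def l using deg0 disj f(1) sum by (intro left_mult_div_pair) auto
  ultimately show ?thesis by blast
qed

end
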